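(* Let $f,g,h\in L^1_{\mathrm{loc}}(\mathbb{R})$ be arbitrary, set $F=-e^{Pg}f$, $H=e^{-Pg}h$, and $$M=\psi(f,g,h)=\begin{pmatrix}e^{\frac12 Pg}C_{F,H}&e^{\frac12 Pg}S_{H,F}\\ e^{-\frac12 Pg}S_{F,H}&e^{-\frac12 Pg}C_{H,F}\end{pmatrix}.$$ For $y_0\in\mathbb{C}$ consider the function $$y(x)=\varphi_{M(x)}(y_0)=e^{Pg(x)}\,\frac{y_0C_{F,H}(x)+S_{H,F}(x)}{y_0S_{F,H}(x)+C_{H,F}(x)}\in\widehat{\mathbb{C}}\qquad(x\in\mathbb{R})\qquad ( * )$$ and the Riccati initial value problem $$y'=fy^2+gy+h,\qquad y(0)=y_0.\qquad ( ** )$$ 1. For every $y_0\in\mathbb{C}\setminus\Sigma_M$, the function $( * )$ is the unique standard solution to $( ** )$. 2. For every $y_0\in\Sigma_M$, the function $( * )$ satisfies $\mathcal{S}y\in AC_{\mathrm{loc}}(\mathbb{R},S^2)$. 3. If $f^{-1}(0)$ has measure zero, then for every $y_0\in\Sigma_M$, equation $( ** )$ holds almost everywhere for the function $( * )$, and the function $( * )$ is the unique projective solution to $( ** )$.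
   Context: $L^1_{\mathrm{loc}}(\mathbb{R})$ denotes the space of locally integrable complex valued functions on $\mathbb{R}$; $AC_{\mathrm{loc}}(\mathbb{R})$ the locally absolutely continuous complex valued functions; $AC_{\mathrm{loc}}(\mathbb{R},S^2)$ the locally absolutely continuous functions from $\mathbb{R}$ to the unit sphere $S^2\subset\mathbb{R}^3$ (with the Euclidean metric of $\mathbb{R}^3$). For $u\in L^1_{\mathrm{loc}}(\mathbb{R})$, $Pu(x)=\int_0^x u$. For $u,v\in L^1_{\mathrm{loc}}(\mathbb{R})$ and $j\ge 1$ let $T^{(j)}_{u,v}(s_1,\ldots,s_j)=u(s_1)v(s_2)u(s_3)\cdots$ ($j$ factors, alternating $u$ with $v$, beginning with $u$). Set $A_0(u,v,x)=1$ and, for $j\geq 1$, $$A_j(u,v,x)=\int_{0<s_1<\cdots<s_j<x}T^{(j)}_{u,v}(s_1,\ldots,s_j)\,ds_1\cdots ds_j\quad (x\ge 0),$$ $$A_j(u,v,x)=(-1)^j\int_{x<s_j<\cdots<s_1<0}T^{(j)}_{u,v}(s_1,\ldots,s_j)\,ds_1\cdots ds_j\quad (x\le 0).$$ The bivariate exponential is $E_{u,v}(x)=1+\sum_{j=1}^\infty A_j(u,v,x)$ for $x\in\mathbb{R}$, and $$C_{u,v}=\tfrac12\bigl(E_{u,v}+E_{-u,-v}\bigr),\qquad S_{u,v}=\tfrac12\bigl(E_{u,v}-E_{-u,-v}\bigr).$$ The matrix $M(x)$ has determinant $1$ for every $x$, and its entries are locally absolutely continuous. $\widehat{\mathbb{C}}=\mathbb{C}\cup\{\infty\}$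 is the Riemann sphere. For an invertible matrix $N=\begin{pmatrix}a&b\\c&d\end{pmatrix}$, $\varphi_N(z)=\frac{az+b}{cz+d}$ for $z\in\widehat{\mathbb{C}}$ (value $\infty$ when the denominator vanishes). For $M=\begin{pmatrix}a&b\\c&d\end{pmatrix}$ a matrix function on $\mathbb{R}$, the singular curve is $\Sigma_M=\{-d(x)/c(x)\mid x\in\mathbb{R},\ c(x)\ne 0\}\subset\mathbb{C}$. Stereographic projection $\mathcal{S}:\widehat{\mathbb{C}}\to S^2$ is $\mathcal{S}(z)=\frac{1}{|z|^2+1}\bigl(2\,\mathrm{Re}\,z,\,2\,\mathrm{Im}\,z,\,|z|^2-1\bigr)$ for $z\in\mathbb{C}$, and $\mathcal{S}(\infty)=(0,0,1)$. A standard solution to the Riccati equation is a function $y\in AC_{\mathrm{loc}}(\mathbb{R})$ for which the equation holds almost everywhere. A projective solution is a function $y:\mathbb{R}\to\widehat{\mathbb{C}}$ such that $\mathcal{S}y\in AC_{\mathrm{loc}}(\mathbb{R},S^2)$ and the equation holds almost everywhere (so at almost every $x$, $y(x)$ is finite, $y$ is differentiable at $x$, and the equation holds at $x$). *)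

theory Defs
  imports "HOL-Analysis.Analysis"
begin

definition L1_loc :: "(real \<Rightarrow> complex) set" where
  "L1_loc = {u. \<forall>a b. u absolutely_integrable_on {a..b}}"

text \<open>The finite families of non-overlapping intervals are encoded as finite sets of pairs of
  endpoints; degenerate pairs contribute nothing to either sum.\<close>

definition absolutely_continuous_fun_on :: "real \<Rightarrow> real \<Rightarrow> (real \<Rightarrow> 'a::metric_space) \<Rightarrow> bool" where
  "absolutely_continuous_fun_on a b y \<longleftrightarrow>
    (\<forall>\<epsilon>>0. \<exists>\<delta>>0. \<forall>D :: (real \<times> real) set.
      finite D \<and> (\<forall>(s, t)\<in>D. a \<le> s \<and> s \<le> t \<and> t \<le> b) \<and>
      disjoint_family_on (\<lambda>(s, t). {s<..<t}) D \<and> (\<Sum>(s, t)\<in>D. t - s) < \<delta>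
      \<longrightarrow> (\<Sum>(s, t)\<in>D. dist (y s) (y t)) < \<epsilon>)"

definition AC_loc :: "'a::metric_space set \<Rightarrow> (real \<Rightarrow> 'a) set" where
  "AC_loc S = {y. range y \<subseteq> S \<and> (\<forall>a b. absolutely_continuous_fun_on a b y)}"

definition primitive :: "(real \<Rightarrow> complex) \<Rightarrow> real \<Rightarrow> complex" where
  "primitive u x = (LINT s=ereal 0..ereal x|lebesgue. u s)"

definition alternating_product ::
    "(real \<Rightarrow> complex) \<Rightarrow> (real \<Rightarrow> complex) \<Rightarrow> nat \<Rightarrow> (nat \<Rightarrow> real) \<Rightarrow> complex" where
  "alternating_product u v j s = (\<Prod>i\<in>{1..j}. if odd i then u (s i) else v (s i))"

text \<open>Points of \<open>\<real>\<^sup>j\<close> are functions on \<open>{1..j}\<close>. The product is taken over \<^const>\<open>lebesgue\<close>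
  rather than \<^const>\<open>lborel\<close>, because \<open>u\<close> and \<open>v\<close> are only Lebesgue measurable.\<close>

definition iterated_integral ::
    "nat \<Rightarrow> (real \<Rightarrow> complex) \<Rightarrow> (real \<Rightarrow> complex) \<Rightarrow> real \<Rightarrow> complex" where
  "iterated_integral j u v x =
    (if j = 0 then 1
     else if 0 \<le> x then
       (LINT s:{s. strict_mono_on {1..j} s \<and> s ` {1..j} \<subseteq> {0<..<x}}|(\<Pi>\<^sub>M i\<in>{1..j}. lebesgue).
          alternating_product u v j s)
     else (-1) ^ j *
       (LINT s:{s. strict_antimono_on {1..j} s \<and> s ` {1..j} \<subseteq> {x<..<0}}|(\<Pi>\<^sub>M i\<in>{1..j}. lebesgue).
          alternating_product u v j s))"

definition biv_exp :: "(real \<Rightarrow> complex) \<Rightarrow> (real \<Rightarrow> complex) \<Rightarrow> real \<Rightarrow> complex" where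
  "biv_exp u v x = 1 + (\<Sum>j. iterated_integral (Suc j) u v x)"

definition biv_cosh :: "(real \<Rightarrow> complex) \<Rightarrow> (real \<Rightarrow> complex) \<Rightarrow> real \<Rightarrow> complex" where
  "biv_cosh u v x = (biv_exp u v x + biv_exp (\<lambda>t. - u t) (\<lambda>t. - v t) x) / 2"

definition biv_sinh :: "(real \<Rightarrow> complex) \<Rightarrow> (real \<Rightarrow> complex) \<Rightarrow> real \<Rightarrow> complex" where
  "biv_sinh u v x = (biv_exp u v x - biv_exp (\<lambda>t. - u t) (\<lambda>t. - v t) x) / 2"

datatype riemann_sphere = Fin complex | Infty

fun linear_fractional :: "complex^2^2 \<Rightarrow> riemann_sphere \<Rightarrow> riemann_sphere" where
  "linear_fractional N (Fin z) =
    (if N$2$1 * z + N$2$2 = 0 then Infty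
     else Fin ((N$1$1 * z + N$1$2) / (N$2$1 * z + N$2$2)))"
| "linear_fractional N Infty = (if N$2$1 = 0 then Infty else Fin (N$1$1 / N$2$1))"

definition singular_curve :: "(real \<Rightarrow> complex^2^2) \<Rightarrow> complex set" where
  "singular_curve M = {- (M x$2$2) / (M x$2$1) | x. M x$2$1 \<noteq> 0}"

fun stereographic :: "riemann_sphere \<Rightarrow> real^3" where
  "stereographic (Fin z) =
    (1 / ((cmod z)\<^sup>2 + 1)) *\<^sub>R vector [2 * Re z, 2 * Im z, (cmod z)\<^sup>2 - 1]"
| "stereographic Infty = vector [0, 0, 1]"

text \<open>Differentiability at a point where the sphere-valued function is finite: near that point it
  is given by a complex-valued function that is differentiable there.\<close>

definition has_sphere_derivative :: "(real \<Rightarrow> riemann_sphere) \<Rightarrow> complex \<Rightarrow> real \<Rightarrow> bool" where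
  "has_sphere_derivative y D x \<longleftrightarrow>
    (\<exists>w. (\<forall>\<^sub>F t in nhds x. y t = Fin (w t)) \<and> (w has_vector_derivative D) (at x))"

definition riccati_ae ::
    "(real \<Rightarrow> complex) \<Rightarrow> (real \<Rightarrow> complex) \<Rightarrow> (real \<Rightarrow> complex) \<Rightarrow> (real \<Rightarrow> riemann_sphere) \<Rightarrow> bool" where
  "riccati_ae f g h y \<longleftrightarrow>
    (AE x in lebesgue. \<exists>z. y x = Fin z \<and>
       has_sphere_derivative y (f x * z\<^sup>2 + g x * z + h x) x)"

definition standard_solution ::
    "(real \<Rightarrow> complex) \<Rightarrow> (real \<Rightarrow> complex) \<Rightarrow> (real \<Rightarrow> complex) \<Rightarrow> complex \<Rightarrow> (real \<Rightarrow> complex) \<Rightarrow> bool" where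
  "standard_solution f g h y0 y \<longleftrightarrow>
    y \<in> AC_loc UNIV \<and>
    (AE x in lebesgue. (y has_vector_derivative f x * (y x)\<^sup>2 + g x * y x + h x) (at x)) \<and>
    y 0 = y0"

definition projective_solution ::
    "(real \<Rightarrow> complex) \<Rightarrow> (real \<Rightarrow> complex) \<Rightarrow> (real \<Rightarrow> complex) \<Rightarrow> complex \<Rightarrow>
      (real \<Rightarrow> riemann_sphere) \<Rightarrow> bool" where
  "projective_solution f g h y0 y \<longleftrightarrow>
    stereographic \<circ> y \<in> AC_loc (sphere 0 1) \<and> riccati_ae f g h y \<and> y 0 = Fin y0"

end

theory Submission
  imports Defs
begin

text \<open>The iterated integrals satisfy a recursion, because the largest variable can be integrated last;
  hence \<open>C\<^sub>u\<^sub>,\<^sub>v' = v S\<^sub>u\<^sub>,\<^sub>v\<close> and \<open>S\<^sub>u\<^sub>,\<^sub>v' = u C\<^sub>u\<^sub>,\<^sub>v\<close> almost everywhere. The numerator \<open>p\<close> (including the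
  factor \<open>e\<^sup>P\<^sup>g\<close>) and the denominator \<open>q\<close> of the solution formula therefore solve the linear system
  \<open>p' = g p + h q\<close>, \<open>q' = - f p\<close>, and by the determinant identity they have no common zero. This gives the
  Riccati equation wherever \<open>q \<noteq> 0\<close>, and absolute continuity of the stereographic image everywhere. If \<open>f\<close>
  vanishes only on a null set, then so does \<open>q\<close>, since almost all of its zeros are simple. Uniqueness follows
  from a linear differential equation for the squared chordal distance of two solutions.\<close>

subsection \<open>Locally absolutely continuous functions\<close>

text \<open>The coefficients are only locally integrable, so derivatives are known almost everywhere
  only. Every passage from derivatives back to functions therefore rests on one principle: a locally
  absolutely continuous function with derivative zero almost everywhere is constant. It gives the
  representation by primitives, the determinant identity, and the vanishing of a solution of a
  linear equation that starts at 0. Uniqueness cannot be tested on the difference of two solutions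
  in the plane, since this has no value at a pole. The chordal distance stays bounded there and is
  locally absolutely continuous along projective solutions. A standard solution embeds as a
  projective one, so a single argument settles both kinds of uniqueness. The condition on the zeros
  of \<open>f\<close> enters because \<open>q' = - f p\<close>: on an interval where
  \<open>f\<close> vanishes, \<open>q\<close> is constant and may be constantly 0, and then the
  solution is infinite on a set of positive measure.\<close>

lemma AC_loc_UNIV: "y \<in> AC_loc UNIV \<longleftrightarrow> (\<forall>a b. absolutely_continuous_fun_on a b y)"
  by (simp add: AC_loc_def)

lemma AC_loc_iff_range: "y \<in> AC_loc S \<longleftrightarrow> range y \<subseteq> S \<and> y \<in> AC_loc UNIV"
  by (simp add: AC_loc_def)

lemma AC_locE:
  fixes y :: "real \<Rightarrow> 'a::metric_space"
  assumes "y \<in> AC_loc UNIV" "0 < e"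
  obtains d where "0 < d"
    and "\<And>D. finite D \<Longrightarrow> (\<And>s t. (s, t) \<in> D \<Longrightarrow> a \<le> s \<and> s \<le> t \<and> t \<le> b) \<Longrightarrow>
      disjoint_family_on (\<lambda>(s, t). {s<..<t}) D \<Longrightarrow> (\<Sum>(s, t)\<in>D. t - s) < d \<Longrightarrow>
      (\<Sum>(s, t)\<in>D. dist (y s) (y t)) < e"
proof -
  have "\<exists>\<delta>>0. \<forall>D :: (real \<times> real) set.
      finite D \<and> (\<forall>(s, t)\<in>D. a \<le> s \<and> s \<le> t \<and> t \<le> b) \<and>
      disjoint_family_on (\<lambda>(s, t). {s<..<t}) D \<and> (\<Sum>(s, t)\<in>D. t - s) < \<delta>
      \<longrightarrow> (\<Sum>(s, t)\<in>D. dist (y s) (y t)) < e"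
    using assms by (simp add: AC_loc_UNIV absolutely_continuous_fun_on_def)
  then obtain d where "d > 0" and d: "\<And>D :: (real \<times> real) set.
      finite D \<and> (\<forall>(s, t)\<in>D. a \<le> s \<and> s \<le> t \<and> t \<le> b) \<and>
      disjoint_family_on (\<lambda>(s, t). {s<..<t}) D \<and> (\<Sum>(s, t)\<in>D. t - s) < d
      \<longrightarrow> (\<Sum>(s, t)\<in>D. dist (y s) (y t)) < e"
    by auto
  show ?thesis
  proof (rule that[OF \<open>d > 0\<close>])
    fix D :: "(real \<times> real) set"
    assume "finite D" "\<And>s t. (s, t) \<in> D \<Longrightarrow> a \<le> s \<and> s \<le> t \<and> t \<le> b"
      "disjoint_family_on (\<lambda>(s, t). {s<..<t}) D" "(\<Sum>(s, t)\<in>D. t - s) < d"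
    then show "(\<Sum>(s, t)\<in>D. dist (y s) (y t)) < e"
      using d[of D] by blast
  qed
qed

lemma AC_loc_continuous_on:
  fixes y :: "real \<Rightarrow> 'a::metric_space"
  assumes "y \<in> AC_loc UNIV"
  shows "continuous_on A y"
proof -
  have "isCont y x" for x
    unfolding continuous_at_eps_delta
  proof (intro allI impI)
    fix e :: real assume "0 < e"
    then obtain d where "d > 0" and
      d: "\<And>D. finite D \<Longrightarrow> (\<And>s t. (s, t) \<in> D \<Longrightarrow> x - 1 \<le> s \<and> s \<le> t \<and> t \<le> x + 1) \<Longrightarrow>
        disjoint_family_on (\<lambda>(s, t). {s<..<t}) D \<Longrightarrow> (\<Sum>(s, t)\<in>D. t - s) < d \<Longrightarrow>
        (\<Sum>(s, t)\<in>D. dist (y s) (y t)) < e"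
      using AC_locE[OF assms] by blast
    show "\<exists>d>0. \<forall>x'. dist x' x < d \<longrightarrow> dist (y x') (y x) < e"
    proof (intro exI conjI allI impI)
      \<comment> \<open>The 1 keeps \<open>x'\<close> inside the window around \<open>x\<close> for
        which \<open>d\<close> was chosen; the test family is the single interval between
        \<open>x\<close> and \<open>x'\<close>.\<close>
      fix x' assume x': "dist x' x < min d 1"
      show "dist (y x') (y x) < e"
        using d[of "{(x, x')}"] d[of "{(x', x)}"] x'
        by (cases "x \<le> x'") (auto simp: disjoint_family_on_def dist_real_def dist_commute abs_if split: if_splits)
    qed (use \<open>d > 0\<close> in auto)
  qed
  then show ?thesis
    by (simp add: continuous_at_imp_continuous_on)
qed

lemma AC_loc_bounded:
  fixes y :: "real \<Rightarrow> 'a::real_normed_vector"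
  assumes "y \<in> AC_loc UNIV"
  obtains B where "0 < B" "\<And>x. x \<in> {a..b} \<Longrightarrow> norm (y x) \<le> B"
proof -
  have "bounded (y ` {a..b})"
    by (intro compact_imp_bounded compact_continuous_image AC_loc_continuous_on assms) auto
  then show ?thesis
    using that unfolding bounded_pos by auto
qed

text \<open>The Lipschitz estimate can be summed over any family of intervals. The closure
  properties below reduce to it: each only has to supply a constant on a compact interval.\<close>

lemma AC_loc_dominated2:
  fixes y1 :: "real \<Rightarrow> 'a::metric_space" and y2 :: "real \<Rightarrow> 'b::metric_space"
    and y :: "real \<Rightarrow> 'c::metric_space"
  assumes "y1 \<in> AC_loc UNIV" "y2 \<in> AC_loc UNIV"
    and L: "\<And>a b. \<exists>L. \<forall>s\<in>{a..b}. \<forall>t\<in>{a..b}. dist (y s) (y t) \<le> L * (dist (y1 s) (y1 t) + dist (y2 s) (y2 t))"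
  shows "y \<in> AC_loc UNIV"
  unfolding AC_loc_UNIV absolutely_continuous_fun_on_def
proof (intro allI impI)
  fix a b e :: real assume "0 < e"
  obtain L0 where L0: "\<And>s t. s \<in> {a..b} \<Longrightarrow> t \<in> {a..b} \<Longrightarrow>
      dist (y s) (y t) \<le> L0 * (dist (y1 s) (y1 t) + dist (y2 s) (y2 t))"
    using L by meson
  \<comment> \<open>\<open>L0\<close> may be zero or negative, while the tolerance
    \<open>e / (2 * L1)\<close> requires a positive constant.\<close>
  define L1 where "L1 = max L0 1"
  have "L1 > 0"
    by (auto simp: L1_def)
  have L1: "dist (y s) (y t) \<le> L1 * (dist (y1 s) (y1 t) + dist (y2 s) (y2 t))"
    if "s \<in> {a..b}" "t \<in> {a..b}" for s t
    by (rule order_trans[OF L0[OF that]]) (auto simp: L1_def intro!: mult_right_mono)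
  let ?E = "e / (2 * L1)"
  have E: "?E > 0"
    using \<open>0 < e\<close> \<open>L1 > 0\<close> by simp
  obtain d1 where "d1 > 0" and
    d1: "\<And>D. finite D \<Longrightarrow> (\<And>s t. (s, t) \<in> D \<Longrightarrow> a \<le> s \<and> s \<le> t \<and> t \<le> b) \<Longrightarrow>
      disjoint_family_on (\<lambda>(s, t). {s<..<t}) D \<Longrightarrow> (\<Sum>(s, t)\<in>D. t - s) < d1 \<Longrightarrow>
      (\<Sum>(s, t)\<in>D. dist (y1 s) (y1 t)) < ?E"
    using AC_locE[OF assms(1) E] by blast
  obtain d2 where "d2 > 0" and
    d2: "\<And>D. finite D \<Longrightarrow> (\<And>s t. (s, t) \<in> D \<Longrightarrow> a \<le> s \<and> s \<le> t \<and> t \<le> b) \<Longrightarrow>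
      disjoint_family_on (\<lambda>(s, t). {s<..<t}) D \<Longrightarrow> (\<Sum>(s, t)\<in>D. t - s) < d2 \<Longrightarrow>
      (\<Sum>(s, t)\<in>D. dist (y2 s) (y2 t)) < ?E"
    using AC_locE[OF assms(2) E] by blast
  show "\<exists>\<delta>>0. \<forall>D :: (real \<times> real) set.
      finite D \<and> (\<forall>(s, t)\<in>D. a \<le> s \<and> s \<le> t \<and> t \<le> b) \<and>
      disjoint_family_on (\<lambda>(s, t). {s<..<t}) D \<and> (\<Sum>(s, t)\<in>D. t - s) < \<delta>
      \<longrightarrow> (\<Sum>(s, t)\<in>D. dist (y s) (y t)) < e"
  proof (intro exI conjI allI impI)
    show "min d1 d2 > 0"
      using \<open>d1 > 0\<close> \<open>d2 > 0\<close> by simp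
    fix D :: "(real \<times> real) set"
    assume D: "finite D \<and> (\<forall>(s, t)\<in>D. a \<le> s \<and> s \<le> t \<and> t \<le> b) \<and>
      disjoint_family_on (\<lambda>(s, t). {s<..<t}) D \<and> (\<Sum>(s, t)\<in>D. t - s) < min d1 d2"
    have "(\<Sum>(s, t)\<in>D. dist (y s) (y t)) \<le> (\<Sum>(s, t)\<in>D. L1 * (dist (y1 s) (y1 t) + dist (y2 s) (y2 t)))"
      using D by (intro sum_mono) (force intro!: L1)
    also have "\<dots> = L1 * ((\<Sum>(s, t)\<in>D. dist (y1 s) (y1 t)) + (\<Sum>(s, t)\<in>D. dist (y2 s) (y2 t)))"
      by (simp add: sum_distrib_left sum.distrib split_def distrib_left)
    also have "\<dots> < L1 * (?E + ?E)"
      using d1[of D] d2[of D] D by (intro mult_strict_left_mono add_strict_mono \<open>L1 > 0\<close>) auto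
    also have "\<dots> = e"
      using \<open>L1 > 0\<close> by (simp add: field_simps)
    finally show "(\<Sum>(s, t)\<in>D. dist (y s) (y t)) < e" .
  qed
qed

lemma AC_loc_dominated:
  fixes y1 :: "real \<Rightarrow> 'a::metric_space" and y :: "real \<Rightarrow> 'c::metric_space"
  assumes "y1 \<in> AC_loc UNIV"
    and "\<And>a b. \<exists>L. \<forall>s\<in>{a..b}. \<forall>t\<in>{a..b}. dist (y s) (y t) \<le> L * dist (y1 s) (y1 t)"
  shows "y \<in> AC_loc UNIV"
proof (rule AC_loc_dominated2[OF assms(1) assms(1)])
  fix a b
  obtain L where "\<forall>s\<in>{a..b}. \<forall>t\<in>{a..b}. dist (y s) (y t) \<le> L * dist (y1 s) (y1 t)"
    using assms(2) by blast
  then show "\<exists>L. \<forall>s\<in>{a..b}. \<forall>t\<in>{a..b}. dist (y s) (y t) \<le> L * (dist (y1 s) (y1 t) + dist (y1 s) (y1 t))"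
    \<comment> \<open>The same function fills both slots, so its increment is counted twice.\<close>
    by (intro exI[of _ "L/2"]) simp
qed

section \<open>Closure properties of local absolute continuity\<close>

lemma AC_loc_const: "(\<lambda>x. c) \<in> AC_loc UNIV"
  by (auto simp: AC_loc_UNIV absolutely_continuous_fun_on_def intro!: exI[of _ 1])

lemma AC_loc_add:
  fixes y1 y2 :: "real \<Rightarrow> 'a::real_normed_vector"
  assumes "y1 \<in> AC_loc UNIV" "y2 \<in> AC_loc UNIV"
  shows "(\<lambda>x. y1 x + y2 x) \<in> AC_loc UNIV"
  by (rule AC_loc_dominated2[OF assms], rule exI[of _ 1])
    (simp add: dist_triangle_add)

lemma (in bounded_linear) AC_loc:
  assumes "y \<in> AC_loc UNIV"
  shows "(\<lambda>x. f (y x)) \<in> AC_loc UNIV"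
proof -
  obtain K where K: "\<And>x. norm (f x) \<le> norm x * K"
    using bounded by blast
  show ?thesis
    by (rule AC_loc_dominated[OF assms], rule exI[of _ K])
      (use K in \<open>auto simp: dist_norm diff[symmetric] mult.commute\<close>)
qed

text \<open>Changing one factor at a time, with the other bounded on the compact interval, gives the
  estimate. The bilinear form serves multiplication, scaling and the inner product alike.\<close>

lemma (in bounded_bilinear) AC_loc:
  assumes y1: "y1 \<in> AC_loc UNIV" and y2: "y2 \<in> AC_loc UNIV"
  shows "(\<lambda>x. prod (y1 x) (y2 x)) \<in> AC_loc UNIV"
proof (rule AC_loc_dominated2[OF assms])
  fix a b :: real
  obtain K where K: "0 < K" "\<And>u v. norm (prod u v) \<le> norm u * norm v * K"
    using pos_bounded by blast
  obtain B1 where B1: "0 < B1" "\<And>x. x \<in> {a..b} \<Longrightarrow> norm (y1 x) \<le> B1"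
    using AC_loc_bounded[OF y1] by blast
  obtain B2 where B2: "0 < B2" "\<And>x. x \<in> {a..b} \<Longrightarrow> norm (y2 x) \<le> B2"
    using AC_loc_bounded[OF y2] by blast
  show "\<exists>L. \<forall>s\<in>{a..b}. \<forall>t\<in>{a..b}. dist (prod (y1 s) (y2 s)) (prod (y1 t) (y2 t))
      \<le> L * (dist (y1 s) (y1 t) + dist (y2 s) (y2 t))"
  proof (intro exI ballI)
    fix s t assume st: "s \<in> {a..b}" "t \<in> {a..b}"
    have "prod (y1 s) (y2 s) - prod (y1 t) (y2 t) = prod (y1 s - y1 t) (y2 s) + prod (y1 t) (y2 s - y2 t)"
      by (simp add: diff_left diff_right)
    then have "dist (prod (y1 s) (y2 s)) (prod (y1 t) (y2 t))
        \<le> norm (prod (y1 s - y1 t) (y2 s)) + norm (prod (y1 t) (y2 s - y2 t))"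
      by (simp add: dist_norm norm_triangle_ineq)
    also have "\<dots> \<le> norm (y1 s - y1 t) * B2 * K + B1 * norm (y2 s - y2 t) * K"
      by (intro add_mono order_trans[OF K(2)] mult_right_mono mult_left_mono B1 B2 st)
        (use K B1 in auto)
    also have "\<dots> \<le> ((B1 + B2) * K) * (norm (y1 s - y1 t) + norm (y2 s - y2 t))"
      using K B1 B2 by (simp add: algebra_simps)
    finally show "dist (prod (y1 s) (y2 s)) (prod (y1 t) (y2 t))
        \<le> ((B1 + B2) * K) * (dist (y1 s) (y1 t) + dist (y2 s) (y2 t))"
      by (simp add: dist_norm)
  qed
qed

lemmas AC_loc_mult = bounded_bilinear.AC_loc[OF bounded_bilinear_mult]
lemmas AC_loc_scaleR = bounded_bilinear.AC_loc[OF bounded_bilinear_scaleR]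

lemma AC_loc_inverse:
  fixes y :: "real \<Rightarrow> 'a::real_normed_field"
  assumes y: "y \<in> AC_loc UNIV" and nz: "\<And>x. y x \<noteq> 0"
  shows "(\<lambda>x. inverse (y x)) \<in> AC_loc UNIV"
proof (rule AC_loc_dominated[OF y])
  fix a b :: real
  have "continuous_on {a..b} (\<lambda>x. inverse (y x))"
    by (intro continuous_intros AC_loc_continuous_on y) (use nz in auto)
  then have "bounded ((\<lambda>x. inverse (y x)) ` {a..b})"
    by (intro compact_imp_bounded compact_continuous_image) auto
  then obtain B where B: "0 < B" "\<And>x. x \<in> {a..b} \<Longrightarrow> norm (inverse (y x)) \<le> B"
    unfolding bounded_pos by auto
  show "\<exists>L. \<forall>s\<in>{a..b}. \<forall>t\<in>{a..b}. dist (inverse (y s)) (inverse (y t)) \<le> L * dist (y s) (y t)"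
  proof (intro exI ballI)
    fix s t assume st: "s \<in> {a..b}" "t \<in> {a..b}"
    have "dist (inverse (y s)) (inverse (y t)) = norm (inverse (y s)) * norm (y s - y t) * norm (inverse (y t))"
      by (simp add: dist_norm inverse_diff_inverse nz norm_mult)
    also have "\<dots> \<le> B * norm (y s - y t) * B"
      by (intro mult_mono B st) (use B in auto)
    finally show "dist (inverse (y s)) (inverse (y t)) \<le> (B * B) * dist (y s) (y t)"
      by (simp add: dist_norm mult_ac)
  qed
qed

lemma AC_loc_exp:
  fixes y :: "real \<Rightarrow> complex"
  assumes y: "y \<in> AC_loc UNIV"
  shows "(\<lambda>x. exp (y x)) \<in> AC_loc UNIV"
proof (rule AC_loc_dominated[OF y])
  fix a b :: real
  obtain B where B: "0 < B" "\<And>x. x \<in> {a..b} \<Longrightarrow> norm (y x) \<le> B"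
    using AC_loc_bounded[OF y] by blast
  show "\<exists>L. \<forall>s\<in>{a..b}. \<forall>t\<in>{a..b}. dist (exp (y s)) (exp (y t)) \<le> L * dist (y s) (y t)"
  proof (intro exI ballI)
    fix s t assume st: "s \<in> {a..b}" "t \<in> {a..b}"
    have "norm (exp (y s) - exp (y t)) \<le> exp B * norm (y s - y t)"
    \<comment> \<open>The mean value estimate needs a convex set that contains all values of
      \<open>y\<close> on the interval; on this ball the derivative of the exponential is at most
      \<open>exp B\<close>.\<close>
    proof (rule field_differentiable_bound[where S = "cball 0 B" and f' = exp])
      fix z :: complex assume "z \<in> cball 0 B"
      then have "Re z \<le> B"
        using complex_Re_le_cmod[of z] by simp
      then show "norm (exp z) \<le> exp B"
        by simp
    qed (use B st in \<open>auto intro!: derivative_eq_intros\<close>)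
    then show "dist (exp (y s)) (exp (y t)) \<le> exp B * dist (y s) (y t)"
      by (simp add: dist_norm)
  qed
qed

text \<open>Around the exceptional null set the gauge is taken inside an open set of small measure, so
  that absolute continuity controls the intervals tagged there; elsewhere the vanishing derivative
  does.\<close>

lemma AC_loc_zero_derivative_imp_const:
  fixes y :: "real \<Rightarrow> 'a::real_normed_vector"
  assumes y: "y \<in> AC_loc UNIV"
    and ae: "AE x in lebesgue. (y has_vector_derivative 0) (at x)"
  shows "y a = y b"
proof -
  have *: "dist (y a) (y b) \<le> e" if "a \<le> b" "e > 0" for a b e
  proof -
    \<comment> \<open>The slope is chosen so that the intervals tagged outside the null set
      contribute at most \<open>e / 2\<close> in total; the summand 1 prevents division by zero when
      \<open>a = b\<close>.\<close>
    define e2 where "e2 = e / (2 * (b - a + 1))"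
    have "e2 > 0" and e2: "e2 * (b - a) \<le> e / 2"
      using that by (auto simp: e2_def field_simps)
    have "e / 2 > 0"
      using \<open>e > 0\<close> by simp
    then obtain d where "d > 0" and
      d: "\<And>D. finite D \<Longrightarrow> (\<And>s t. (s, t) \<in> D \<Longrightarrow> a \<le> s \<and> s \<le> t \<and> t \<le> b) \<Longrightarrow>
        disjoint_family_on (\<lambda>(s, t). {s<..<t}) D \<Longrightarrow> (\<Sum>(s, t)\<in>D. t - s) < d \<Longrightarrow>
        (\<Sum>(s, t)\<in>D. dist (y s) (y t)) < e / 2"
      using AC_locE[OF y] by blast
    obtain N where N: "N \<in> null_sets lebesgue" "\<And>x. x \<notin> N \<Longrightarrow> (y has_vector_derivative 0) (at x)"
      using ae by (auto elim!: AE_E3)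
    have "N \<in> sets lebesgue" using N(1) by auto
    then obtain U where U: "open U" "N \<subseteq> U" "(U - N) \<in> lmeasurable" "emeasure lebesgue (U - N) < ennreal d"
      using sets_lebesgue_outer_open \<open>d > 0\<close> by blast
    have "emeasure lebesgue U = emeasure lebesgue (U - N)"
      using emeasure_Diff_null_set[OF N(1), of U] U(1) by auto
    then have Ud: "emeasure lebesgue U < ennreal d"
      using U by simp
    have "\<exists>r>0. \<forall>t. \<bar>t - x\<bar> < r \<longrightarrow> norm (y t - y x) \<le> e2 * \<bar>t - x\<bar>" if "x \<notin> N" for x
    proof -
      have "(y has_derivative (\<lambda>h. 0)) (at x)"
        using N(2)[OF that] by (simp add: has_vector_derivative_def)
      then show ?thesis
        using \<open>e2 > 0\<close> unfolding has_derivative_at_alt by auto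
    qed
    then obtain r where r: "\<And>x. x \<notin> N \<Longrightarrow> r x > 0"
      "\<And>x t. x \<notin> N \<Longrightarrow> \<bar>t - x\<bar> < r x \<Longrightarrow> norm (y t - y x) \<le> e2 * \<bar>t - x\<bar>"
      by metis
    define g where "g x = (if x \<in> N then U else ball x (r x))" for x
    have "gauge g"
      using r U by (auto simp: gauge_def g_def)
    then obtain p where p: "p tagged_division_of {a..b}" "g fine p"
      using fine_division_exists_real by blast
    note pD = tagged_division_ofD[OF p(1)]
    \<comment> \<open>A tagged division consists of tags and sets, absolute continuity speaks of
      pairs of endpoints; \<open>c\<close> translates and forgets the tag.\<close>
    define c where "c x = (Inf (snd x), Sup (snd x))" for x :: "real \<times> real set"
    have K: "\<exists>s t. K = {s..t} \<and> s \<le> t \<and> a \<le> s \<and> t \<le> b \<and> c (x, K) = (s, t) \<and> s \<le> x \<and> x \<le> t" if "(x, K) \<in> p" for x K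
    proof -
      have "\<exists>s t. K = {s..t}"
        using pD(4)[OF that] by auto
      then obtain s t where st: "K = {s..t}"
        by blast
      moreover have "x \<in> K" "K \<subseteq> {a..b}"
        using pD(2,3)[OF that] by auto
      ultimately show ?thesis
        by (intro exI[of _ s] exI[of _ t]) (auto simp: c_def)
    qed
    define pN where "pN = {q \<in> p. fst q \<in> N}"
    have pN: "finite pN" "pN \<subseteq> p"
      using pD(1) by (auto simp: pN_def)
    \<comment> \<open>Distinct members of the division have disjoint interiors, so only degenerate
      intervals could share their endpoints. These contribute 0 to the sums in question, so the sums
      may be reindexed by endpoint pairs.\<close>
    have inj: "c q = c q' \<Longrightarrow> q = q' \<or> fst (c q) = snd (c q)" and
      disj: "c q \<noteq> c q' \<Longrightarrow> {fst (c q)<..<snd (c q)} \<inter> {fst (c q')<..<snd (c q')} = {}"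
      if q: "q \<in> p" "q' \<in> p" for q q'
    proof -
      obtain x K x' K' where qq: "q = (x, K)" "q' = (x', K')" by fastforce
      obtain s t where st: "K = {s..t}" "s \<le> t" "c (x, K) = (s, t)" using K q qq by blast
      obtain s' t' where st': "K' = {s'..t'}" "s' \<le> t'" "c (x', K') = (s', t')" using K q qq by blast
      have int: "interior K \<inter> interior K' = {}" if "q \<noteq> q'"
        using pD(5) q that unfolding qq by blast
      show "q = q' \<or> fst (c q) = snd (c q)" if "c q = c q'"
      proof (rule ccontr)
        assume "\<not> ?thesis"
        then have "q \<noteq> q'" "s < t" "s = s'" "t = t'"
          using st st' qq that by auto
        then show False
          using int st st' by (auto simp: interior_atLeastAtMost_real)
      qed
      show "{fst (c q)<..<snd (c q)} \<inter> {fst (c q')<..<snd (c q')} = {}" if "c q \<noteq> c q'"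
        using int that st st' qq by (auto simp: interior_atLeastAtMost_real)
    qed
    have reidx: "(\<Sum>q\<in>c ` pN. \<phi> q) = (\<Sum>q\<in>pN. \<phi> (c q))" if "\<And>s. \<phi> (s, s) = 0" for \<phi> :: "real \<times> real \<Rightarrow> real"
    proof (rule sum.reindex_nontrivial[unfolded o_def, OF pN(1)])
      fix q q' assume "q \<in> pN" "q' \<in> pN" "q \<noteq> q'" "c q = c q'"
      then have "fst (c q) = snd (c q)"
        using inj pN by blast
      then show "\<phi> (c q) = 0"
        using that by (metis prod.collapse)
    qed
    have disjN: "disjoint_family_on (\<lambda>(s, t). {s<..<t}) (c ` pN)"
      unfolding disjoint_family_on_def split_def
    proof (intro ballI impI)
      fix m n assume "m \<in> c ` pN" "n \<in> c ` pN" "m \<noteq> n"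
      then show "{fst m<..<snd m} \<inter> {fst n<..<snd n} = {}"
        using disj pN(2) by blast
    qed
    have rngN: "a \<le> fst q \<and> fst q \<le> snd q \<and> snd q \<le> b \<and> {fst q<..<snd q} \<subseteq> U" if "q \<in> c ` pN" for q
    proof -
      from that obtain x L where xL: "(x, L) \<in> pN" "q = c (x, L)"
        by auto
      obtain s t where st: "L = {s..t}" "s \<le> t" "a \<le> s" "t \<le> b" "c (x, L) = (s, t)"
        using K xL pN by blast
      have "L \<subseteq> U"
        using p(2) xL unfolding fine_def g_def pN_def by fastforce
      then show ?thesis
        using st xL by auto
    qed
    have "(\<Sum>q\<in>c ` pN. snd q - fst q) < d"
    proof -
      have "ennreal (\<Sum>q\<in>c ` pN. snd q - fst q) = (\<Sum>q\<in>c ` pN. emeasure lebesgue {fst q<..<snd q})"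
        by (subst sum_ennreal[symmetric]) (simp_all add: rngN)
      also have "\<dots> = emeasure lebesgue (\<Union>q\<in>c ` pN. {fst q<..<snd q})"
        by (intro sum_emeasure disjN[unfolded split_def] finite_imageI pN) auto
      also have "\<dots> \<le> emeasure lebesgue U"
        by (intro emeasure_mono UN_least) (use rngN U(1) in auto)
      finally have "ennreal (\<Sum>q\<in>c ` pN. snd q - fst q) < ennreal d"
        using Ud by simp
      then show ?thesis
        by (subst (asm) ennreal_less_iff) (simp_all add: sum_nonneg rngN)
    qed
    then have N1: "(\<Sum>q\<in>c ` pN. dist (y (fst q)) (y (snd q))) < e / 2"
      using d[of "c ` pN"] pN rngN disjN by (auto simp: split_def)
    have "dist (y a) (y b) = norm (\<Sum>(x, K)\<in>p. y (Sup K) - y (Inf K))"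
      using additive_tagged_division_1[OF \<open>a \<le> b\<close> p(1), of y] by (simp add: dist_norm norm_minus_commute)
    also have "\<dots> \<le> (\<Sum>q\<in>p. dist (y (fst (c q))) (y (snd (c q))))"
      by (rule order_trans[OF norm_sum]) (simp add: c_def split_def dist_norm norm_minus_commute)
    also have "\<dots> = (\<Sum>q\<in>p - pN. dist (y (fst (c q))) (y (snd (c q)))) + (\<Sum>q\<in>pN. dist (y (fst (c q))) (y (snd (c q))))"
      by (rule sum.subset_diff) (fact pN(2) pD(1))+
    finally have "dist (y a) (y b) \<le> \<dots>" .
    moreover have "(\<Sum>q\<in>pN. dist (y (fst (c q))) (y (snd (c q)))) < e / 2"
      using N1 by (subst (asm) reidx) simp_all
    moreover have "(\<Sum>q\<in>p - pN. dist (y (fst (c q))) (y (snd (c q)))) \<le> (\<Sum>q\<in>p - pN. e2 * (snd (c q) - fst (c q)))"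
    proof (rule sum_mono)
      fix q assume "q \<in> p - pN"
      then obtain x L where xL: "q = (x, L)" "(x, L) \<in> p" "x \<notin> N"
        by (cases q) (auto simp: pN_def)
      obtain s t where st: "L = {s..t}" "s \<le> t" "a \<le> s" "t \<le> b" "c (x, L) = (s, t)" "s \<le> x" "x \<le> t"
        using K[OF xL(2)] by blast
      have "L \<subseteq> ball x (r x)"
        using p(2) xL unfolding fine_def g_def by fastforce
      moreover have "s \<in> L" "t \<in> L"
        using st(2) by (simp_all add: st(1))
      ultimately have "s \<in> ball x (r x)" "t \<in> ball x (r x)"
        by blast+
      then have "\<bar>s - x\<bar> < r x" "\<bar>t - x\<bar> < r x"
        by (simp_all add: dist_real_def abs_minus_commute)
      \<comment> \<open>The differentiability estimate is based at the tag, so the increment is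
        split there; since \<open>s \<le> x \<le> t\<close>, the two bounds add up to
        \<open>e2 * (t - s)\<close>.\<close>
      then have "norm (y s - y x) \<le> e2 * (x - s)" "norm (y t - y x) \<le> e2 * (t - x)"
        using r(2)[OF xL(3), of s] r(2)[OF xL(3), of t] st by auto
      moreover have "dist (y s) (y t) \<le> norm (y s - y x) + norm (y t - y x)"
        by (metis dist_norm dist_triangle2)
      ultimately show "dist (y (fst (c q))) (y (snd (c q))) \<le> e2 * (snd (c q) - fst (c q))"
        using xL st by (simp add: algebra_simps)
    qed
    moreover have "(\<Sum>q\<in>p - pN. e2 * (snd (c q) - fst (c q))) \<le> (\<Sum>q\<in>p. e2 * (snd (c q) - fst (c q)))"
    proof (rule sum_mono2[OF pD(1)])
      fix q assume "q \<in> p - (p - pN)"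
      then have "q \<in> p" by blast
      obtain x L where "q = (x, L)" by fastforce
      then show "0 \<le> e2 * (snd (c q) - fst (c q))"
        using K[of x L] \<open>e2 > 0\<close> \<open>q \<in> p\<close> by auto
    qed blast
    moreover have "(\<Sum>q\<in>p. e2 * (snd (c q) - fst (c q))) = e2 * (b - a)"
      using additive_tagged_division_1[OF \<open>a \<le> b\<close> p(1), of "\<lambda>x. x"]
      by (simp add: sum_distrib_left[symmetric] c_def split_def)
    ultimately show ?thesis
      using e2 by linarith
  qed
  have "dist (y a) (y b) \<le> 0" if "a \<le> b" for a b
    using *[OF that] field_le_epsilon[of "dist (y a) (y b)" 0] by simp
  then show ?thesis
    by (metis zero_less_dist_iff linear not_less)
qed

subsection \<open>Primitives of locally integrable functions\<close>

lemma L1_locD: "u \<in> L1_loc \<Longrightarrow> u absolutely_integrable_on {a..b}"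
  by (simp add: L1_loc_def)

lemma L1_locD': "u \<in> L1_loc \<Longrightarrow> u integrable_on {a..b}"
  by (blast intro: L1_locD set_lebesgue_integral_eq_integral(1))

lemma L1_loc_add: "u \<in> L1_loc \<Longrightarrow> v \<in> L1_loc \<Longrightarrow> (\<lambda>x. u x + v x) \<in> L1_loc"
  by (auto simp: L1_loc_def)

lemma L1_loc_linear: "u \<in> L1_loc \<Longrightarrow> bounded_linear l \<Longrightarrow> (\<lambda>x. l (u x)) \<in> L1_loc"
  unfolding L1_loc_def using absolutely_integrable_linear[where f = u and h = l] by (auto simp: o_def)

lemma L1_loc_uminus: "u \<in> L1_loc \<Longrightarrow> (\<lambda>x. - u x) \<in> L1_loc"
  by (erule L1_loc_linear[OF _ bounded_linear_minus[OF bounded_linear_ident]])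

lemma L1_loc_continuous_mult:
  assumes "continuous_on UNIV c" "u \<in> L1_loc"
  shows "(\<lambda>x. c x * u x) \<in> L1_loc"
  unfolding L1_loc_def
proof (intro CollectI allI)
  fix a b :: real
  have c: "continuous_on {a..b} c"
    using assms(1) continuous_on_subset by blast
  show "(\<lambda>x. c x * u x) absolutely_integrable_on {a..b}"
  proof (rule absolutely_integrable_bounded_measurable_product[OF bilinear_times])
    show "c \<in> borel_measurable (lebesgue_on {a..b})"
      using c by (simp add: continuous_imp_measurable_on_sets_lebesgue)
    show "bounded (c ` {a..b})"
      using c by (intro compact_imp_bounded compact_continuous_image) auto
  qed (use L1_locD[OF assms(2)] in auto)
qed

text \<open>The norm is cast back to the complex numbers because \<open>L1_loc\<close> and
  \<open>primitive\<close> are defined for complex functions; such norms serve as majorants of the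
  iterated integrals.\<close>

lemma L1_loc_norm:
  assumes "u \<in> L1_loc"
  shows "(\<lambda>x. complex_of_real (norm (u x))) \<in> L1_loc"
  unfolding L1_loc_def
proof (intro CollectI allI)
  fix a b :: real
  have "(\<lambda>x. norm (u x)) absolutely_integrable_on {a..b}"
    using L1_locD[OF assms] by (rule absolutely_integrable_norm[unfolded o_def])
  then show "(\<lambda>x. complex_of_real (norm (u x))) absolutely_integrable_on {a..b}"
    using absolutely_integrable_linear[OF _ bounded_linear_of_real] by (auto simp: o_def)
qed

text \<open>Translates the Lebesgue integral over an open interval into the gauge integral over the
  closed one, where additivity over adjacent intervals and the differentiation theorem are
  applied.\<close>

lemma primitive_nonneg:
  assumes "u \<in> L1_loc" "0 \<le> x"
  shows "primitive u x = integral {0..x} u"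
proof -
  have "u absolutely_integrable_on {0<..<x}"
    using L1_locD[OF assms(1), of 0 x] by (rule set_integrable_subset) auto
  then have "(LINT s:{0<..<x}|lebesgue. u s) = integral {0<..<x} u"
    by (rule set_lebesgue_integral_eq_integral)
  then show ?thesis
    using assms(2) by (simp add: primitive_def interval_lebesgue_integral_def integral_open_interval_real)
qed

lemma primitive_nonpos:
  assumes "u \<in> L1_loc" "x \<le> 0"
  shows "primitive u x = - integral {x..0} u"
proof -
  have "u absolutely_integrable_on {x<..<0}"
    using L1_locD[OF assms(1), of x 0] by (rule set_integrable_subset) auto
  then have "(LINT s:{x<..<0}|lebesgue. u s) = integral {x<..<0} u"
    by (rule set_lebesgue_integral_eq_integral)
  then show ?thesis
    using assms(2) by (auto simp: primitive_def interval_lebesgue_integral_def integral_open_interval_real)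
qed

lemma primitive_0 [simp]: "primitive u 0 = 0"
  by (simp add: primitive_def interval_lebesgue_integral_def set_lebesgue_integral_def)

lemma primitive_diff:
  assumes u: "u \<in> L1_loc" and "a \<le> b"
  shows "primitive u b - primitive u a = integral {a..b} u"
proof -
  consider "0 \<le> a" | "a \<le> 0" "0 \<le> b" | "b \<le> 0" by linarith
  then show ?thesis
  proof cases
    case 1
    then show ?thesis
      using Henstock_Kurzweil_Integration.integral_combine[of 0 a b u] \<open>a \<le> b\<close> L1_locD'[OF u]
      by (simp add: primitive_nonneg[OF u] algebra_simps)
  next
    case 2
    then show ?thesis
      using Henstock_Kurzweil_Integration.integral_combine[of a 0 b u] L1_locD'[OF u]
      by (simp add: primitive_nonneg[OF u] primitive_nonpos[OF u] algebra_simps)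
  next
    case 3
    then show ?thesis
      using Henstock_Kurzweil_Integration.integral_combine[of a b 0 u] \<open>a \<le> b\<close> L1_locD'[OF u]
      by (simp add: primitive_nonpos[OF u] algebra_simps)
  qed
qed

text \<open>At each point the excess over the level \<open>n\<close> is eventually 0, and it never
  exceeds the absolute value of the function, so dominated convergence applies.\<close>

lemma integral_truncation_tendsto_0:
  fixes \<phi> :: "'a \<Rightarrow> real"
  assumes \<phi>: "integrable M \<phi>"
  shows "(\<lambda>n. integral\<^sup>L M (\<lambda>x. max (\<phi> x - real n) 0)) \<longlonglongrightarrow> 0"
proof -
  have "(\<lambda>n. integral\<^sup>L M (\<lambda>x. max (\<phi> x - real n) 0)) \<longlonglongrightarrow> integral\<^sup>L M (\<lambda>x. 0)"
  proof (rule integral_dominated_convergence[where w = "\<lambda>x. \<bar>\<phi> x\<bar>"])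
    show "AE x in M. (\<lambda>n. max (\<phi> x - real n) 0) \<longlonglongrightarrow> 0"
    proof (intro AE_I2)
      fix x
      have "eventually (\<lambda>n. max (\<phi> x - real n) 0 = 0) sequentially"
        using eventually_ge_at_top[of "nat \<lceil>\<phi> x\<rceil>"]
        by eventually_elim (auto simp: max_def nat_ceiling_le_eq)
      then show "(\<lambda>n. max (\<phi> x - real n) 0) \<longlonglongrightarrow> 0"
        by (rule tendsto_eventually)
    qed
  qed (use \<phi> in auto)
  then show ?thesis
    by simp
qed

text \<open>Absolute continuity of the integral: the part of \<open>\<bar>u\<bar>\<close> above a large level \<open>n\<close> has small
  integral, and below that level a total length \<open>\<delta>\<close> contributes at most \<open>n \<delta>\<close>.\<close>

lemma primitive_AC_loc:
  assumes u: "u \<in> L1_loc"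
  shows "primitive u \<in> AC_loc UNIV"
  unfolding AC_loc_UNIV absolutely_continuous_fun_on_def
proof (intro allI impI)
  fix a b e :: real assume "0 < e"
  define \<phi> where "\<phi> x = indicator {a..b} x * norm (u x)" for x
  have \<phi>: "integrable lebesgue \<phi>"
    using integrable_norm[OF L1_locD[OF u, of a b, unfolded set_integrable_def]]
    by (simp add: \<phi>_def[abs_def])
  have "eventually (\<lambda>n. integral\<^sup>L lebesgue (\<lambda>x. max (\<phi> x - real n) 0) < e / 2) sequentially"
    using integral_truncation_tendsto_0[OF \<phi>] \<open>0 < e\<close> by (intro order_tendstoD) auto
  then obtain n where n: "integral\<^sup>L lebesgue (\<lambda>x. max (\<phi> x - real n) 0) < e / 2"
    by (auto simp: eventually_sequentially)
  define w where "w x = max (\<phi> x - real n) 0" for x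
  have w: "integrable lebesgue w" "\<And>x. 0 \<le> w x" "\<And>x. \<phi> x \<le> real n + w x"
    unfolding w_def using \<phi>
    by (auto intro!: Bochner_Integration.integrable_bound[OF \<phi>])
  show "\<exists>\<delta>>0. \<forall>D :: (real \<times> real) set.
      finite D \<and> (\<forall>(s, t)\<in>D. a \<le> s \<and> s \<le> t \<and> t \<le> b) \<and>
      disjoint_family_on (\<lambda>(s, t). {s<..<t}) D \<and> (\<Sum>(s, t)\<in>D. t - s) < \<delta>
      \<longrightarrow> (\<Sum>(s, t)\<in>D. dist (primitive u s) (primitive u t)) < e"
  proof (intro exI conjI allI impI)
    \<comment> \<open>With this total length the part below level \<open>n\<close> contributes at
      most \<open>e / 2\<close>, and the excess \<open>w\<close> has integral below
      \<open>e / 2\<close>; the summand 1 covers \<open>n = 0\<close>.\<close>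
    show "e / (2 * (real n + 1)) > 0"
      using \<open>0 < e\<close> by simp
    fix D :: "(real \<times> real) set"
    assume D: "finite D \<and> (\<forall>(s, t)\<in>D. a \<le> s \<and> s \<le> t \<and> t \<le> b) \<and>
      disjoint_family_on (\<lambda>(s, t). {s<..<t}) D \<and> (\<Sum>(s, t)\<in>D. t - s) < e / (2 * (real n + 1))"
    then have D1: "finite D" and D2: "\<And>q. q \<in> D \<Longrightarrow> a \<le> fst q \<and> fst q \<le> snd q \<and> snd q \<le> b"
      and D3: "disjoint_family_on (\<lambda>q. {fst q<..<snd q}) D"
      and D4: "(\<Sum>q\<in>D. snd q - fst q) < e / (2 * (real n + 1))"
      by (auto simp: split_def)
    let ?I = "\<lambda>q x. indicator {fst q<..<snd q} x :: real"
    have iw: "integrable lebesgue (\<lambda>x. ?I q x * w x)" for q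
      using integrable_mult_indicator[OF _ w(1), of "{fst q<..<snd q}"] by simp
    have le: "dist (primitive u (fst q)) (primitive u (snd q)) \<le>
        real n * (snd q - fst q) + (LINT x|lebesgue. ?I q x * w x)" if q: "q \<in> D" for q
    proof -
      have ui: "u absolutely_integrable_on {fst q<..<snd q}"
        using L1_locD[OF u, of "fst q" "snd q"] by (rule set_integrable_subset) auto
      have "dist (primitive u (fst q)) (primitive u (snd q)) = norm (integral {fst q<..<snd q} u)"
        using primitive_diff[OF u, of "fst q" "snd q"] D2[OF q]
        by (subst dist_commute) (simp add: dist_norm integral_open_interval_real)
      also have "\<dots> = norm (LINT x:{fst q<..<snd q}|lebesgue. u x)"
        using set_lebesgue_integral_eq_integral(2)[OF ui] by simp
      also have "\<dots> \<le> (LINT x|lebesgue. norm (indicator {fst q<..<snd q} x *\<^sub>R u x))"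
        unfolding set_lebesgue_integral_def by (rule integral_norm_bound)
      also have "\<dots> \<le> (LINT x|lebesgue. real n * ?I q x + ?I q x * w x)"
      proof (rule integral_mono)
        show "integrable lebesgue (\<lambda>x. norm (indicator {fst q<..<snd q} x *\<^sub>R u x))"
          using ui unfolding set_integrable_def by (rule integrable_norm)
        show "integrable lebesgue (\<lambda>x. real n * ?I q x + ?I q x * w x)"
          by (intro Bochner_Integration.integrable_add iw integrable_mult_right integrable_real_indicator) (auto simp: D2[OF q])
        fix x
        show "norm (indicator {fst q<..<snd q} x *\<^sub>R u x) \<le> real n * ?I q x + ?I q x * w x"
          using w(3)[of x] D2[OF q] by (auto simp: \<phi>_def indicator_def split: if_splits)
      qed
      also have "\<dots> = real n * (LINT x|lebesgue. ?I q x) + (LINT x|lebesgue. ?I q x * w x)"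
        by (subst Bochner_Integration.integral_add) (auto intro!: iw integrable_real_indicator simp: D2[OF q])
      also have "(LINT x|lebesgue. ?I q x) = snd q - fst q"
        using D2[OF q] by simp
      finally show ?thesis .
    qed
    \<comment> \<open>Disjointness of the intervals enters here: the excess \<open>w\<close> is
      counted at most once at each point, however many intervals there are.\<close>
    have le1: "(\<Sum>q\<in>D. ?I q x) \<le> 1" for x
    proof -
      have "(\<Sum>q\<in>D. ?I q x) = indicator (\<Union>q\<in>D. {fst q<..<snd q}) x"
        by (rule indicator_UN_disjoint[OF D1 D3, symmetric])
      then show ?thesis
        by (simp add: indicator_def)
    qed
    have "(\<Sum>(s, t)\<in>D. dist (primitive u s) (primitive u t))
        \<le> (\<Sum>q\<in>D. real n * (snd q - fst q) + (LINT x|lebesgue. ?I q x * w x))"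
      unfolding split_def by (rule sum_mono) (rule le)
    also have "\<dots> = real n * (\<Sum>q\<in>D. snd q - fst q) + (LINT x|lebesgue. (\<Sum>q\<in>D. ?I q x * w x))"
      using iw by (simp add: sum.distrib sum_distrib_left Bochner_Integration.integral_sum)
    also have "(LINT x|lebesgue. (\<Sum>q\<in>D. ?I q x * w x)) \<le> integral\<^sup>L lebesgue w"
    proof (rule integral_mono[OF _ w(1)])
      show "integrable lebesgue (\<lambda>x. \<Sum>q\<in>D. ?I q x * w x)"
        by (intro Bochner_Integration.integrable_sum iw)
      show "(\<Sum>q\<in>D. ?I q x * w x) \<le> w x" for x
        using mult_right_mono[OF le1 w(2), of x] by (simp only: sum_distrib_right mult_1_left)
    qed
    also have "integral\<^sup>L lebesgue w < e / 2"
      using n by (simp add: w_def[abs_def])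
    also have "real n * (\<Sum>q\<in>D. snd q - fst q) \<le> real n * (e / (2 * (real n + 1)))"
      using D4 by (intro mult_left_mono) auto
    also have "\<dots> \<le> e / 2"
      using \<open>0 < e\<close> by (simp add: field_simps)
    finally show "(\<Sum>(s, t)\<in>D. dist (primitive u s) (primitive u t)) < e"
      by simp
  qed
qed

text \<open>The differentiation theorem concerns averages over intervals that begin at
  \<open>x\<close>, hence gives the right derivative only. Applied to the reflected function at
  \<open>- x\<close> it gives the left derivative, and the reflected exceptional set is again
  negligible.\<close>

lemma primitive_has_vector_derivative_AE:
  assumes u: "u \<in> L1_loc"
  shows "AE x in lebesgue. (primitive u has_vector_derivative u x) (at x)"
proof -
  have i1: "u integrable_on cbox a b" for a b
    using L1_locD'[OF u] by simp
  have i2: "(\<lambda>x. u (- x)) integrable_on cbox a b" for a b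
    using i1[of "-b" "-a"] integrable_reflect[of u "-a" "-b"] by simp
  obtain N1 where N1: "negligible N1" and
    d1: "\<And>x e. \<lbrakk>x \<notin> N1; 0 < e\<rbrakk> \<Longrightarrow> \<exists>d>0. \<forall>h. 0 < h \<and> h < d \<longrightarrow>
        norm (integral (cbox x (x + h *\<^sub>R One)) u /\<^sub>R h ^ DIM(real) - u x) < e"
    using integrable_ccontinuous_explicit[OF i1] by metis
  obtain N2 where N2: "negligible N2" and
    d2: "\<And>x e. \<lbrakk>x \<notin> N2; 0 < e\<rbrakk> \<Longrightarrow> \<exists>d>0. \<forall>h. 0 < h \<and> h < d \<longrightarrow>
        norm (integral (cbox x (x + h *\<^sub>R One)) (\<lambda>x. u (- x)) /\<^sub>R h ^ DIM(real) - u (- x)) < e"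
    using integrable_ccontinuous_explicit[OF i2] by metis
  have neg: "negligible (N1 \<union> uminus ` N2)"
    by (intro negligible_Un N1 negligible_differentiable_image_negligible N2) (auto intro!: derivative_intros)
  have scale: "norm (z - h *\<^sub>R w) \<le> e * h" if "norm (z /\<^sub>R h - w) < e" "h > 0" for z w :: complex and h e :: real
  proof -
    have "z - h *\<^sub>R w = h *\<^sub>R (z /\<^sub>R h - w)"
      using that by (simp add: scaleR_diff_right)
    then have "norm (z - h *\<^sub>R w) = h * norm (z /\<^sub>R h - w)"
      using that by simp
    then show ?thesis
      using that by (simp add: mult.commute mult_left_mono less_imp_le)
  qed
  have "(primitive u has_vector_derivative u x) (at x)" if x: "x \<notin> N1 \<union> uminus ` N2" for x
    unfolding has_vector_derivative_def has_derivative_at_alt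
  proof (intro conjI allI impI)
    fix e :: real assume "0 < e"
    have "x \<notin> N1" "- x \<notin> N2"
      using x by (auto simp: image_iff)
    then obtain r1 r2 where r: "r1 > 0" "r2 > 0"
      "\<And>h. 0 < h \<Longrightarrow> h < r1 \<Longrightarrow> norm (integral {x..x + h} u /\<^sub>R h - u x) < e"
      "\<And>h. 0 < h \<Longrightarrow> h < r2 \<Longrightarrow> norm (integral {- x..- x + h} (\<lambda>x. u (- x)) /\<^sub>R h - u x) < e"
      using d1[of x e] d2[of "- x" e] \<open>0 < e\<close> by auto
    show "\<exists>d>0. \<forall>y. norm (y - x) < d \<longrightarrow>
        norm (primitive u y - primitive u x - (y - x) *\<^sub>R u x) \<le> e * norm (y - x)"
    proof (intro exI conjI allI impI)
      show "min r1 r2 > 0"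
        using r by simp
      fix y assume y: "norm (y - x) < min r1 r2"
      consider "y = x" | "y > x" | "y < x" by linarith
      then show "norm (primitive u y - primitive u x - (y - x) *\<^sub>R u x) \<le> e * norm (y - x)"
      proof cases
        case 2
        then show ?thesis
          using scale[OF r(3)[of "y - x"]] y primitive_diff[OF u, of x y] by simp
      next
        case 3
        have "integral {- x..- x + (x - y)} (\<lambda>x. u (- x)) = integral {y..x} u"
          using Henstock_Kurzweil_Integration.integral_reflect_real[of x y u] by simp
        then have "norm ((primitive u x - primitive u y) - (x - y) *\<^sub>R u x) \<le> e * (x - y)"
          using scale[OF r(4)[of "x - y"]] y 3 primitive_diff[OF u, of y x] by simp
        moreover have "primitive u y - primitive u x - (y - x) *\<^sub>R u x =
            - ((primitive u x - primitive u y) - (x - y) *\<^sub>R u x)"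
          by (simp add: algebra_simps)
        ultimately show ?thesis
          using 3 by (simp only: norm_minus_cancel) simp
      qed auto
    qed
  qed (rule bounded_linear_scaleR_left)
  then show ?thesis
    using neg by (intro AE_I'[of "N1 \<union> uminus ` N2"]) (auto simp: negligible_iff_null_sets)
qed

text \<open>The difference of the two sides is locally absolutely continuous with derivative 0
  almost everywhere, hence constant.\<close>

lemma AC_loc_eq_primitive:
  fixes y :: "real \<Rightarrow> complex"
  assumes y: "y \<in> AC_loc UNIV" and u: "u \<in> L1_loc"
    and ae: "AE x in lebesgue. (y has_vector_derivative u x) (at x)"
  shows "y x = y 0 + primitive u x"
proof -
  have "(\<lambda>x. y x + (- primitive u x)) \<in> AC_loc UNIV"
    by (intro AC_loc_add y bounded_linear.AC_loc[OF bounded_linear_minus] primitive_AC_loc u)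
      (rule bounded_linear_ident)
  moreover have "AE x in lebesgue. ((\<lambda>x. y x + (- primitive u x)) has_vector_derivative 0) (at x)"
    using ae primitive_has_vector_derivative_AE[OF u]
    by eventually_elim (auto intro!: derivative_eq_intros)
  ultimately have "y x + (- primitive u x) = y 0 + (- primitive u 0)"
    by (rule AC_loc_zero_derivative_imp_const)
  then show ?thesis
    by (simp add: algebra_simps)
qed

subsection \<open>The recursion for iterated integrals\<close>

text \<open>Borel sets of finite measure that exhaust the space keep their measure under completion.
  Finite products of \<open>lebesgue\<close> and Fubini depend on this.\<close>

lemma sigma_finite_lebesgue: "sigma_finite_measure (lebesgue :: 'a::euclidean_space measure)"
proof
  obtain A :: "'a set set" where A: "countable A" "A \<subseteq> sets lborel" "\<Union>A = space lborel" "\<forall>a\<in>A. emeasure lborel a \<noteq> \<infinity>"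
    using lborel.sigma_finite_countable by blast
  then show "\<exists>A. countable A \<and> A \<subseteq> sets lebesgue \<and> \<Union>A = space lebesgue \<and>
      (\<forall>a\<in>A. emeasure (lebesgue :: 'a measure) a \<noteq> \<infinity>)"
    by (intro exI[of _ A]) (auto simp: subset_iff)
qed

text \<open>With \<open>(<)\<close> this is the integral over the simplex for
  \<open>x \<ge> 0\<close>, with \<open>(>)\<close> the one for negative \<open>x\<close> without
  its sign. The order is a parameter so that both half-lines share one recursion.\<close>

definition ordered_integral ::
    "(real \<Rightarrow> real \<Rightarrow> bool) \<Rightarrow> nat \<Rightarrow> (real \<Rightarrow> complex) \<Rightarrow> (real \<Rightarrow> complex) \<Rightarrow> real \<Rightarrow> complex" where
  "ordered_integral ord j u v x =
    (LINT s:{s. monotone_on {1..j} (<) ord s \<and> s ` {1..j} \<subseteq> {t. ord 0 t \<and> ord t x}}|(\<Pi>\<^sub>M i\<in>{1..j}. lebesgue).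
       alternating_product u v j s)"

text \<open>The product over no coordinates has total mass 1 and the region imposes no condition, so
  the recursion can start from the index 0.\<close>

lemma ordered_integral_0: "ordered_integral ord 0 u v x = 1"
proof -
  have "ordered_integral ord 0 u v x = (LINT s|(\<Pi>\<^sub>M i\<in>({}::nat set). (lebesgue :: real measure)). (1::complex))"
    by (simp add: ordered_integral_def set_lebesgue_integral_def alternating_product_def monotone_on_def)
  also have "\<dots> = 1"
    by (simp add: measure_def space_PiM_empty)
  finally show ?thesis .
qed

text \<open>The coordinate of largest index lies farthest from 0, so it alone must be compared with
  \<open>x\<close>. It takes over the role of \<open>x\<close> for the remaining coordinates, whose
  bound by \<open>x\<close> then comes from transitivity.\<close>

lemma ordered_region_Suc:
  assumes "transp ord"
  shows "monotone_on {1..Suc j} (<) ord (s(Suc j := y)) \<and>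
      (s(Suc j := y)) ` {1..Suc j} \<subseteq> {t. ord 0 t \<and> ord t x} \<longleftrightarrow>
    (ord 0 y \<and> ord y x) \<and> monotone_on {1..j} (<) ord s \<and> s ` {1..j} \<subseteq> {t. ord 0 t \<and> ord t y}"
    (is "?L \<longleftrightarrow> ?R")
proof
  assume L: ?L
  then have m: "\<And>p q. p \<in> {1..Suc j} \<Longrightarrow> q \<in> {1..Suc j} \<Longrightarrow> p < q \<Longrightarrow> ord ((s(Suc j := y)) p) ((s(Suc j := y)) q)"
    and b: "\<And>p. p \<in> {1..Suc j} \<Longrightarrow> ord 0 ((s(Suc j := y)) p) \<and> ord ((s(Suc j := y)) p) x"
    unfolding monotone_on_def image_subset_iff by blast+
  have "ord (s p) (s q)" if "p \<in> {1..j}" "q \<in> {1..j}" "p < q" for p q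
    using m[of p q] that by (auto split: if_splits)
  moreover have "ord 0 (s p) \<and> ord (s p) y" if "p \<in> {1..j}" for p
    using m[of p "Suc j"] b[of p] that by (auto split: if_splits)
  ultimately show ?R
    using b[of "Suc j"] by (auto simp: monotone_on_def)
next
  assume R: ?R
  then have m: "\<And>p q. p \<in> {1..j} \<Longrightarrow> q \<in> {1..j} \<Longrightarrow> p < q \<Longrightarrow> ord (s p) (s q)"
    and b: "\<And>p. p \<in> {1..j} \<Longrightarrow> ord 0 (s p) \<and> ord (s p) y"
    unfolding monotone_on_def image_subset_iff by blast+
  have b': "ord (s p) x" if "p \<in> {1..j}" for p
    using b[OF that] R assms by (meson transpD)
  have "ord ((s(Suc j := y)) p) ((s(Suc j := y)) q)" if "p \<in> {1..Suc j}" "q \<in> {1..Suc j}" "p < q" for p q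
    using m[of p q] b[of p] that by (cases "q = Suc j") auto
  moreover have "ord 0 ((s(Suc j := y)) p) \<and> ord ((s(Suc j := y)) p) x" if "p \<in> {1..Suc j}" for p
    using b[of p] b'[of p] that R by (cases "p = Suc j") auto
  ultimately show ?L
    by (auto simp: monotone_on_def simp del: fun_upd_apply)
qed

text \<open>Finitely many strict comparisons of coordinates describe the region. It is intersected
  with the space because its elements are functions on all natural numbers, while points of the
  product are fixed outside the index set.\<close>

lemma ordered_region_sets:
  assumes ord: "ord = (<) \<or> ord = (>)"
  shows "{s \<in> space (\<Pi>\<^sub>M i\<in>{1..j}. lebesgue). monotone_on {1..j} (<) ord s \<and>
      s ` {1..j} \<subseteq> {t. ord 0 t \<and> ord t x}} \<in> sets (\<Pi>\<^sub>M i\<in>{1..j::nat}. (lebesgue :: real measure))"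
proof -
  let ?P = "\<Pi>\<^sub>M i\<in>{1..j}. (lebesgue :: real measure)"
  have c: "(\<lambda>s. s i) \<in> borel_measurable ?P" if "i \<in> {1..j}" for i
    using measurable_comp[OF measurable_component_singleton[OF that, of "\<lambda>_. lebesgue"]
        measurable_completion[OF measurable_ident_sets[OF sets_lborel]]]
    by (simp add: o_def)
  have k: "{s \<in> space ?P. ord (a s) (b s)} \<in> sets ?P"
    if "a \<in> borel_measurable ?P" "b \<in> borel_measurable ?P" for a b
    using ord that by (auto intro: borel_measurable_less)
  have "{s \<in> space ?P. \<forall>p\<in>{1..j}. (\<forall>q\<in>{1..j}. p < q \<longrightarrow> ord (s p) (s q)) \<and> ord 0 (s p) \<and> ord (s p) x} \<in> sets ?P"
    by (intro sets.sets_Collect_finite_All sets.sets_Collect_conj sets.sets_Collect_imp k c finite_atLeastAtMost)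
      (auto intro!: sets.sets_Collect_const)
  also have "{s \<in> space ?P. \<forall>p\<in>{1..j}. (\<forall>q\<in>{1..j}. p < q \<longrightarrow> ord (s p) (s q)) \<and> ord 0 (s p) \<and> ord (s p) x} =
    {s \<in> space ?P. monotone_on {1..j} (<) ord s \<and> s ` {1..j} \<subseteq> {t. ord 0 t \<and> ord t x}}"
    by (auto simp: monotone_on_def)
  finally show ?thesis .
qed

text \<open>\<open>product_integral_insert\<close> has the new coordinate innermost, whereas the
  recursion needs it outermost. The exchange requires joint integrability on the pair space, which
  Tonelli for the norm provides.\<close>

lemma (in product_sigma_finite) product_integral_insert_rev:
  fixes f :: "_ \<Rightarrow> _::{banach, second_countable_topology}"
  assumes I: "finite I" "i \<notin> I"
    and f: "integrable (Pi\<^sub>M (insert i I) M) f"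
  shows "integral\<^sup>L (Pi\<^sub>M (insert i I) M) f = (\<integral>y. (\<integral>x. f (x(i:=y)) \<partial>Pi\<^sub>M I M) \<partial>M i)"
proof -
  interpret I: finite_product_sigma_finite M I by standard fact
  interpret P: pair_sigma_finite "Pi\<^sub>M I M" "M i" ..
  have [measurable]: "f \<in> borel_measurable (Pi\<^sub>M (insert i I) M)"
    using f by auto
  have meas: "(\<lambda>(x, y). f (x(i := y))) \<in> borel_measurable (Pi\<^sub>M I M \<Otimes>\<^sub>M M i)"
    using measurable_compose[OF measurable_add_dim \<open>f \<in> _\<close>] by (simp add: split_def)
  have "(\<integral>\<^sup>+ z. ennreal (norm (case z of (x, y) \<Rightarrow> f (x(i := y)))) \<partial>(Pi\<^sub>M I M \<Otimes>\<^sub>M M i)) =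
      (\<integral>\<^sup>+ x. \<integral>\<^sup>+ y. ennreal (norm (f (x(i := y)))) \<partial>M i \<partial>Pi\<^sub>M I M)"
    using meas by (subst sigma_finite_measure.nn_integral_fst[OF sigma_finite_measures, symmetric]) simp_all
  also have "\<dots> = (\<integral>\<^sup>+ x. ennreal (norm (f x)) \<partial>Pi\<^sub>M (insert i I) M)"
    by (rule product_nn_integral_insert[symmetric]) (use I in auto)
  also have "\<dots> < \<infinity>"
    using f by (simp add: integrable_iff_bounded)
  finally have "integrable (Pi\<^sub>M I M \<Otimes>\<^sub>M M i) (\<lambda>(x, y). f (x(i := y)))"
    using meas by (simp add: integrable_iff_bounded)
  then show ?thesis
    unfolding product_integral_insert[OF I f] by (rule P.Fubini_integral[symmetric])
qed

lemma ordered_integral_Suc: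
  assumes u: "u \<in> L1_loc" and v: "v \<in> L1_loc" and ord: "ord = (<) \<or> ord = (>)"
  shows "ordered_integral ord (Suc j) u v x =
    (LINT y:{t. ord 0 t \<and> ord t x}|lebesgue. (if odd (Suc j) then u y else v y) * ordered_integral ord j u v y)"
proof -
  interpret product_sigma_finite "\<lambda>_::nat. (lebesgue :: real measure)"
    by (simp add: product_sigma_finite_def sigma_finite_lebesgue)
  have tr: "transp ord"
    using ord by auto
  define w where "w i = (if odd i then u else v)" for i :: nat
  let ?P = "\<lambda>j. \<Pi>\<^sub>M i\<in>{1..j}. (lebesgue :: real measure)"
  define R where "R j x = {s. monotone_on {1..j} (<) ord s \<and> s ` {1..j} \<subseteq> {t. ord 0 t \<and> ord t x}}"
    for j :: nat and x
  define \<Phi> where "\<Phi> s = indicator (R (Suc j) x) s *\<^sub>R alternating_product u v (Suc j) s" for s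
  \<comment> \<open>The weights are integrable on bounded intervals only. The ordered region lies in
    the cube over \<open>{-\<bar>x\<bar>..\<bar>x\<bar>}\<close>, so truncation does not alter them
    there and makes their product integrable on the whole space.\<close>
  define W where "W i t = indicator {-\<bar>x\<bar>..\<bar>x\<bar>} t *\<^sub>R w i t" for i :: nat and t
  have ap: "alternating_product u v j s = (\<Prod>i\<in>{1..j}. w i (s i))" for j s
    unfolding alternating_product_def w_def by (rule prod.cong) auto
  have W: "integrable lebesgue (W i)" for i
    using L1_locD[OF u] L1_locD[OF v] unfolding W_def[abs_def] w_def set_integrable_def by auto
  have G: "integrable (?P (Suc j)) (\<lambda>s. \<Prod>i\<in>{1..Suc j}. W i (s i))"
    by (rule product_integrable_prod) (auto intro: W)
  have eq: "\<Phi> s = indicator (space (?P (Suc j)) \<inter> R (Suc j) x) s *\<^sub>R (\<Prod>i\<in>{1..Suc j}. W i (s i))"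
    if s: "s \<in> space (?P (Suc j))" for s
  proof (cases "s \<in> R (Suc j) x")
    case True
    have "W i (s i) = w i (s i)" if "i \<in> {1..Suc j}" for i
    proof -
      have "ord 0 (s i)" "ord (s i) x"
        using True that unfolding R_def image_subset_iff by blast+
      then have "s i \<in> {-\<bar>x\<bar>..\<bar>x\<bar>}"
        using ord by auto
      then show ?thesis
        by (simp add: W_def)
    qed
    then have "(\<Prod>i\<in>{1..Suc j}. W i (s i)) = (\<Prod>i\<in>{1..Suc j}. w i (s i))"
      by (rule prod.cong[OF refl])
    then show ?thesis
      using True s by (simp only: \<Phi>_def ap) (simp add: indicator_def)
  qed (simp add: \<Phi>_def)
  have "space (?P (Suc j)) \<inter> R (Suc j) x \<in> sets (?P (Suc j))"
    using ordered_region_sets[OF ord, of "Suc j" x] by (simp add: R_def Collect_conj_eq[symmetric] Int_def)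
  then have "integrable (?P (Suc j)) (\<lambda>s. indicator (space (?P (Suc j)) \<inter> R (Suc j) x) s *\<^sub>R (\<Prod>i\<in>{1..Suc j}. W i (s i)))"
    by (rule integrable_mult_indicator[OF _ G])
  then have "integrable (?P (Suc j)) \<Phi>"
    by (subst Bochner_Integration.integrable_cong[OF refl eq])
  moreover have ins: "{1..Suc j} = insert (Suc j) {1..j}"
    by auto
  ultimately have i: "integrable (Pi\<^sub>M (insert (Suc j) {1..j}) (\<lambda>_. lebesgue)) \<Phi>"
    by simp
  have eq2: "\<Phi> (s(Suc j := y)) =
      indicator {t. ord 0 t \<and> ord t x} y *\<^sub>R (w (Suc j) y * (indicator (R j y) s *\<^sub>R alternating_product u v j s))" for s y
  proof -
    have "(\<Prod>i\<in>{1..Suc j}. w i ((s(Suc j := y)) i)) = w (Suc j) y * (\<Prod>i\<in>{1..j}. w i (s i))"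
      unfolding ins by (subst prod.insert) (auto intro!: prod.cong)
    moreover have "s(Suc j := y) \<in> R (Suc j) x \<longleftrightarrow> (ord 0 y \<and> ord y x) \<and> s \<in> R j y"
      unfolding R_def mem_Collect_eq by (rule ordered_region_Suc[OF tr])
    ultimately show ?thesis
      unfolding \<Phi>_def ap by (simp add: indicator_def)
  qed
  have "ordered_integral ord (Suc j) u v x = integral\<^sup>L (?P (Suc j)) \<Phi>"
    by (simp only: ordered_integral_def set_lebesgue_integral_def \<Phi>_def[abs_def] R_def)
  also have "\<dots> = (\<integral>y. (\<integral>s. \<Phi> (s(Suc j := y)) \<partial>?P j) \<partial>lebesgue)"
    unfolding ins by (rule product_integral_insert_rev[OF _ _ i]) auto
  also have "\<dots> = (\<integral>y. indicator {t. ord 0 t \<and> ord t x} y *\<^sub>R (w (Suc j) y * ordered_integral ord j u v y) \<partial>lebesgue)"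
    unfolding eq2 ordered_integral_def set_lebesgue_integral_def R_def[symmetric]
    by (simp only: integral_scaleR_right integral_mult_right_zero)
  finally show ?thesis
    by (simp only: set_lebesgue_integral_def w_def if_distrib[of "\<lambda>f. f _"] cong: if_cong)
qed

lemma iterated_integral_eq_ordered:
  "iterated_integral j u v x = (if 0 \<le> x then ordered_integral (<) j u v x
     else (-1) ^ j * ordered_integral (>) j u v x)"
proof (cases "j = 0")
  case True
  then show ?thesis
    by (simp add: iterated_integral_def ordered_integral_0)
next
  case False
  moreover have "{t. t < 0 \<and> x < t} = {x<..<0}"
    by auto
  ultimately show ?thesis
    by (simp add: iterated_integral_def ordered_integral_def greaterThanLessThan_def greaterThan_def lessThan_def Int_def)
qed

lemma iterated_integral_0 [simp]: "iterated_integral 0 u v x = 1"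
  by (simp add: iterated_integral_def)

text \<open>For negative \<open>x\<close> the primitive is minus the integral from \<open>x\<close>
  to 0. This is the sign by which \<open>(-1) ^ Suc j\<close> differs from \<open>(-1) ^ j\<close>,
  so one formula holds on the whole line.\<close>

lemma iterated_integral_Suc:
  assumes u: "u \<in> L1_loc" and v: "v \<in> L1_loc"
  shows "iterated_integral (Suc j) u v x =
    primitive (\<lambda>t. (if odd (Suc j) then u t else v t) * iterated_integral j u v t) x"
proof (cases "0 \<le> x")
  case True
  then have "iterated_integral (Suc j) u v x = ordered_integral (<) (Suc j) u v x"
    by (simp add: iterated_integral_eq_ordered)
  also have "\<dots> = (LINT y:{0<..<x}|lebesgue. (if odd (Suc j) then u y else v y) * ordered_integral (<) j u v y)"
    by (subst ordered_integral_Suc[OF u v]) (simp_all add: greaterThanLessThan_def greaterThan_def lessThan_def Int_def)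
  also have "\<dots> = (LINT y:{0<..<x}|lebesgue. (if odd (Suc j) then u y else v y) * iterated_integral j u v y)"
    by (rule set_lebesgue_integral_cong) (auto simp: iterated_integral_eq_ordered)
  finally show ?thesis
    using True by (simp add: primitive_def interval_lebesgue_integral_def)
next
  case False
  have e: "{t. t < 0 \<and> x < t} = {x<..<0}"
    by auto
  have "iterated_integral (Suc j) u v x = (-1) ^ Suc j * ordered_integral (>) (Suc j) u v x"
    using False by (simp add: iterated_integral_eq_ordered)
  also have "\<dots> = - ((-1) ^ j * (LINT y:{x<..<0}|lebesgue. (if odd (Suc j) then u y else v y) * ordered_integral (>) j u v y))"
    by (subst ordered_integral_Suc[OF u v]) (simp_all add: e)
  also have "(-1) ^ j * (LINT y:{x<..<0}|lebesgue. (if odd (Suc j) then u y else v y) * ordered_integral (>) j u v y) =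
      (LINT y:{x<..<0}|lebesgue. (-1) ^ j * ((if odd (Suc j) then u y else v y) * ordered_integral (>) j u v y))"
    by (rule set_integral_mult_right[symmetric])
  also have "\<dots> = (LINT y:{x<..<0}|lebesgue. (if odd (Suc j) then u y else v y) * iterated_integral j u v y)"
    by (rule set_lebesgue_integral_cong) (auto simp: iterated_integral_eq_ordered)
  finally show ?thesis
    using False by (simp add: primitive_def interval_lebesgue_integral_def)
qed

subsection \<open>The differential system of the bivariate hyperbolic functions\<close>

lemma primitive_of_real:
  assumes "\<And>a b. r integrable_on {a..b}" "(\<lambda>t. complex_of_real (r t)) \<in> L1_loc"
  shows "primitive (\<lambda>t. complex_of_real (r t)) x = of_real (if 0 \<le> x then integral {0..x} r else - integral {x..0} r)"
  using integral_linear[OF assms(1) bounded_linear_of_real[where 'a=complex], unfolded o_def]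
    primitive_nonneg[OF assms(2), of x] primitive_nonpos[OF assms(2), of x]
  by auto

lemma primitive_zero [simp]: "primitive (\<lambda>t. 0) x = 0"
  by (simp add: primitive_def interval_lebesgue_integral_def set_lebesgue_integral_def)

text \<open>The bound is required only between 0 and \<open>x\<close>, because the majorant used for
  the iterated integrals has the right sign only on the side of 0 where \<open>x\<close>
  lies.\<close>

lemma norm_primitive_le:
  assumes f: "f \<in> L1_loc" and r: "\<And>a b. r integrable_on {a..b}"
    and le: "\<And>t. min 0 x \<le> t \<Longrightarrow> t \<le> max 0 x \<Longrightarrow> norm (f t) \<le> r t"
  shows "norm (primitive f x) \<le> \<bar>if 0 \<le> x then integral {0..x} r else - integral {x..0} r\<bar>"
proof (cases "0 \<le> x")
  case True
  then have "norm (integral {0..x} f) \<le> integral {0..x} r"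
    by (intro integral_norm_bound_integral L1_locD' f r le) auto
  then show ?thesis
    using True by (simp add: primitive_nonneg[OF f])
next
  case False
  then have "norm (integral {x..0} f) \<le> integral {x..0} r"
    by (intro integral_norm_bound_integral L1_locD' f r le) auto
  then show ?thesis
    using False by (simp add: primitive_nonpos[OF f])
qed

lemma AC_loc_power:
  fixes y :: "real \<Rightarrow> complex"
  assumes "y \<in> AC_loc UNIV"
  shows "(\<lambda>x. y x ^ n) \<in> AC_loc UNIV"
  by (induction n) (auto intro: AC_loc_const AC_loc_mult assms)

text \<open>The power rule holds wherever \<open>primitive u\<close> has derivative
  \<open>u\<close>, and absolute continuity turns it into an integral identity. It produces the
  factorials in the bound on the iterated integrals.\<close>

lemma primitive_power:
  assumes "u \<in> L1_loc"
  shows "(\<lambda>t. u t * primitive u t ^ n) \<in> L1_loc"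
    and "primitive (\<lambda>t. u t * primitive u t ^ n) x = primitive u x ^ Suc n / of_nat (Suc n)"
proof -
  have pu: "primitive u \<in> AC_loc UNIV"
    by (rule primitive_AC_loc[OF assms])
  show L: "(\<lambda>t. u t * primitive u t ^ n) \<in> L1_loc"
    using L1_loc_continuous_mult[OF AC_loc_continuous_on[OF AC_loc_power[OF pu]] assms, of n]
    by (simp add: mult.commute)
  have "(\<lambda>x. inverse (of_nat (Suc n)) * primitive u x ^ Suc n) \<in> AC_loc UNIV"
    by (intro AC_loc_mult AC_loc_const AC_loc_power pu)
  moreover have "AE x in lebesgue. ((\<lambda>x. inverse (of_nat (Suc n)) * primitive u x ^ Suc n) has_vector_derivative
      u x * primitive u x ^ n) (at x)"
    using primitive_has_vector_derivative_AE[OF assms]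
  proof eventually_elim
    case (elim x)
    have "((\<lambda>z. inverse (of_nat (Suc n)) * z ^ Suc n) has_field_derivative primitive u x ^ n) (at (primitive u x))"
      using DERIV_cmult[OF DERIV_power[OF DERIV_ident, where n = "Suc n"], of "inverse (of_nat (Suc n))"]
      by (simp add: mult.assoc[symmetric] del: of_nat_Suc)
    from field_vector_diff_chain_at[OF elim this] show ?case
      by (simp add: o_def)
  qed
  ultimately show "primitive (\<lambda>t. u t * primitive u t ^ n) x = primitive u x ^ Suc n / of_nat (Suc n)"
    using AC_loc_eq_primitive[OF _ L, of "\<lambda>x. inverse (of_nat (Suc n)) * primitive u x ^ Suc n" x]
    by (simp add: field_simps)
qed

lemma iterated_integral_AC_loc:
  assumes "u \<in> L1_loc" "v \<in> L1_loc"
  shows "iterated_integral j u v \<in> AC_loc UNIV"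
proof (induction j)
  case 0
  have "iterated_integral 0 u v = (\<lambda>x. 1)"
    by auto
  then show ?case
    by (simp add: AC_loc_const)
next
  case (Suc j)
  have "(if odd (Suc j) then u else v) \<in> L1_loc"
    using assms by auto
  from L1_loc_continuous_mult[OF AC_loc_continuous_on[OF Suc] this]
  have "(\<lambda>t. (if odd (Suc j) then u t else v t) * iterated_integral j u v t) \<in> L1_loc"
    by (simp add: if_distrib[of "\<lambda>f. f _"] mult.commute cong: if_cong)
  then have "primitive (\<lambda>t. (if odd (Suc j) then u t else v t) * iterated_integral j u v t) \<in> AC_loc UNIV"
    by (rule primitive_AC_loc)
  moreover have "iterated_integral (Suc j) u v = primitive (\<lambda>t. (if odd (Suc j) then u t else v t) * iterated_integral j u v t)"
    by (rule ext) (rule iterated_integral_Suc[OF assms])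
  ultimately show ?case
    by simp
qed

text \<open>Replacing both weights by \<open>k\<close>, the sum of their norms, removes the
  alternation; an integral of equal weights over the ordered region is the power of the single
  integral divided by \<open>fact j\<close>.\<close>

lemma norm_iterated_integral_le:
  assumes u: "u \<in> L1_loc" and v: "v \<in> L1_loc"
  defines "k \<equiv> \<lambda>t. complex_of_real (norm (u t) + norm (v t))"
  shows "norm (iterated_integral j u v x) \<le> norm (primitive k x) ^ j / fact j"
proof -
  define r where "r t = norm (u t) + norm (v t)" for t
  define R where "R x = (if 0 \<le> x then integral {0..x} r else - integral {x..0} r)" for x
  have k: "k \<in> L1_loc"
    using L1_loc_add[OF L1_loc_norm[OF u] L1_loc_norm[OF v]] by (simp add: k_def)
  have ri: "r integrable_on {a..b}" for a b
    unfolding r_def using L1_locD[OF u, of a b] L1_locD[OF v, of a b]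
    by (intro integrable_add) (auto simp: absolutely_integrable_on_def)
  have kr: "k = (\<lambda>t. complex_of_real (r t))"
    by (auto simp: k_def r_def)
  have kt: "k t = of_real (r t)" for t
    by (simp add: kr)
  have pk: "primitive k x = of_real (R x)" for x
    unfolding kr R_def by (rule primitive_of_real[OF ri]) (use k kr in simp)
  have R: "0 \<le> x \<Longrightarrow> 0 \<le> R x" "x \<le> 0 \<Longrightarrow> R x \<le> 0" for x
    by (auto simp: R_def intro!: integral_nonneg ri) (auto simp: r_def intro!: integral_nonneg ri[unfolded r_def])
  have "norm (iterated_integral j u v x) \<le> \<bar>R x\<bar> ^ j / fact j"
  proof (induction j arbitrary: x)
    case (Suc j)
    let ?f = "\<lambda>t. (if odd (Suc j) then u t else v t) * iterated_integral j u v t"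
    \<comment> \<open>On the negative half-line \<open>primitive k\<close> is nonpositive and its
      power carries the sign \<open>(-1) ^ j\<close>; \<open>c\<close> cancels it, so that
      \<open>s\<close> is a nonnegative majorant between 0 and \<open>x\<close>.\<close>
    define c :: complex where "c = (if 0 \<le> x then 1 else (-1) ^ j)"
    define s where "s t = Re (c * (k t * primitive k t ^ j) / fact j)" for t
    have w: "(if odd (Suc j) then u else v) \<in> L1_loc"
      using u v by auto
    have f: "?f \<in> L1_loc"
      using L1_loc_continuous_mult[OF AC_loc_continuous_on[OF iterated_integral_AC_loc[OF u v]] w, of j]
      by (simp add: if_distrib[of "\<lambda>f. f _"] mult.commute cong: if_cong)
    have sL: "(\<lambda>t. complex_of_real (s t)) \<in> L1_loc"
      unfolding s_def
      by (rule L1_loc_linear[OF primitive_power(1)[OF k]])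
        (intro bounded_linear_intros bounded_linear_compose[OF bounded_linear_of_real] bounded_linear_compose[OF bounded_linear_Re]
          bounded_linear_compose[OF bounded_linear_divide] bounded_linear_mult_right)
    have si: "s integrable_on {a..b}" for a b
      using integrable_linear[OF L1_locD'[OF sL, of a b] bounded_linear_Re] by (simp add: o_def)
    have "norm (primitive ?f x) \<le> \<bar>if 0 \<le> x then integral {0..x} s else - integral {x..0} s\<bar>"
    proof (rule norm_primitive_le[OF f si])
      fix t assume t: "min 0 x \<le> t" "t \<le> max 0 x"
      have "s t = r t * (\<bar>R t\<bar> ^ j / fact j)"
      proof (cases "0 \<le> x")
        case True
        then have "0 \<le> R t"
          using t R by auto
        have "c * (k t * primitive k t ^ j) / fact j = of_real (r t * (R t ^ j / fact j))"
          unfolding pk kt using True by (simp add: c_def)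
        then show ?thesis
          using \<open>0 \<le> R t\<close> by (simp only: s_def Re_complex_of_real abs_of_nonneg)
      next
        case False
        then have "R t \<le> 0"
          using t R by auto
        have "c * (k t * primitive k t ^ j) / fact j = of_real (r t * ((- R t) ^ j / fact j))"
          unfolding pk kt using False by (simp add: c_def power_minus[of "of_real (R t)"])
        then show ?thesis
          using \<open>R t \<le> 0\<close> by (simp only: s_def Re_complex_of_real abs_of_nonpos)
      qed
      moreover have "norm (?f t) \<le> r t * (\<bar>R t\<bar> ^ j / fact j)"
        unfolding norm_mult by (intro mult_mono Suc.IH) (auto simp: r_def)
      ultimately show "norm (?f t) \<le> s t"
        by simp
    qed
    also have "\<dots> = norm (primitive (\<lambda>t. complex_of_real (s t)) x)"
      by (subst primitive_of_real[OF si sL]) simp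
    also have "primitive (\<lambda>t. complex_of_real (s t)) x = primitive (\<lambda>t. c * (k t * primitive k t ^ j) / fact j) x"
    proof -
      have "complex_of_real (s t) = c * (k t * primitive k t ^ j) / fact j" for t
      proof -
        have "(fact j :: complex) \<in> \<real>"
          by (metis Reals_of_nat of_nat_fact)
        then have "c * (k t * primitive k t ^ j) / fact j \<in> \<real>"
          unfolding pk kt c_def by (auto intro!: Reals_mult Reals_divide Reals_power)
        then show ?thesis
          by (simp only: s_def of_real_Re)
      qed
      then show ?thesis
        by simp
    qed
    also have "\<dots> = c * (primitive k x ^ Suc j / of_nat (Suc j)) / fact j"
      unfolding primitive_power(2)[OF k, symmetric] by (simp add: primitive_def)
    also have "norm \<dots> = \<bar>R x\<bar> ^ Suc j / fact (Suc j)"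
      unfolding pk by (simp add: norm_mult norm_divide norm_power c_def divide_simps del: of_nat_Suc)
    finally show ?case
      by (simp only: iterated_integral_Suc[OF u v])
  qed auto
  then show ?thesis
    by (simp add: pk)
qed

text \<open>On a bounded set the terms are dominated by \<open>c j * norm (w t)\<close>, so their
  integrated norms are summable and integration may be carried out term by term.\<close>

lemma primitive_suminf:
  assumes w: "w \<in> L1_loc" and a: "\<And>j. continuous_on UNIV (a j)"
    and le: "\<And>b. \<exists>c. summable c \<and> (\<forall>j t. \<bar>t\<bar> \<le> b \<longrightarrow> norm (a j t) \<le> c j)"
  shows "(\<lambda>t. w t * (\<Sum>j. a j t)) \<in> L1_loc"
    and "(\<lambda>j. primitive (\<lambda>t. w t * a j t) x) sums primitive (\<lambda>t. w t * (\<Sum>j. a j t)) x"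
proof -
  have L: "(\<lambda>t. w t * a j t) \<in> L1_loc" for j
    using L1_loc_continuous_mult[OF a w] by (simp add: mult.commute)
  \<comment> \<open>The set \<open>I\<close> is kept general because \<open>L1_loc\<close> tests
    closed intervals while \<open>primitive\<close> integrates over open ones.\<close>
  have *: "integrable lebesgue (\<lambda>t. indicator I t *\<^sub>R (w t * (\<Sum>j. a j t))) \<and>
      (\<lambda>j. LINT t:I|lebesgue. w t * a j t) sums (LINT t:I|lebesgue. w t * (\<Sum>j. a j t))"
    if I: "I \<in> sets lebesgue" "I \<subseteq> {-b..b}" for I b
  proof -
    obtain c where c: "summable c" "\<And>j t. \<bar>t\<bar> \<le> b \<Longrightarrow> norm (a j t) \<le> c j"
      using le[of b] by blast
    have cI: "norm (a j t) \<le> c j" if "t \<in> I" for j t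
    proof -
      have "t \<in> {-b..b}"
        using that I(2) by blast
      then show ?thesis
        by (intro c(2)) auto
    qed
    have int: "integrable lebesgue (\<lambda>t. indicator I t *\<^sub>R (w t * a j t))" for j
      using set_integrable_subset[OF L1_locD[OF L, of "-b" b] I] by (simp add: set_integrable_def)
    have wint: "integrable lebesgue (\<lambda>t. norm (indicator I t *\<^sub>R w t))"
      using set_integrable_subset[OF L1_locD[OF w, of "-b" b] I]
      unfolding set_integrable_def by (rule integrable_norm)
    have nb: "norm (indicator I t *\<^sub>R (w t * a j t)) \<le> c j * norm (indicator I t *\<^sub>R w t)" for j t
    proof (cases "t \<in> I")
      case True
      from mult_left_mono[OF cI[OF True, of j] norm_ge_zero[of "w t"]] show ?thesis
        using True by (simp add: norm_mult mult.commute)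
    qed simp
    have sum1: "summable (\<lambda>j. norm (indicator I t *\<^sub>R (w t * a j t)))" for t
      by (rule summable_comparison_test'[OF summable_mult2[OF c(1)]]) (use nb in simp)
    have "LINT t|lebesgue. norm (indicator I t *\<^sub>R (w t * a j t)) \<le> c j * (LINT t|lebesgue. norm (indicator I t *\<^sub>R w t))" for j
      unfolding integral_mult_right_zero[symmetric]
      by (rule integral_mono[OF integrable_norm[OF int] integrable_mult_right[OF wint] nb])
    then have sum2: "summable (\<lambda>j. LINT t|lebesgue. norm (indicator I t *\<^sub>R (w t * a j t)))"
      by (intro summable_comparison_test'[OF summable_mult2[OF c(1)]]) simp
    have eq: "(\<Sum>j. indicator I t *\<^sub>R (w t * a j t)) = indicator I t *\<^sub>R (w t * (\<Sum>j. a j t))" for t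
    proof (cases "t \<in> I")
      case True
      have "summable (\<lambda>j. a j t)"
        by (rule summable_comparison_test'[OF c(1)]) (use cI True in auto)
      then show ?thesis
        using True by (simp add: suminf_mult)
    qed simp
    show ?thesis
      using integrable_suminf[OF int _ sum2] sums_integral[OF int _ sum2] sum1
      by (simp add: eq set_lebesgue_integral_def)
  qed
  show "(\<lambda>t. w t * (\<Sum>j. a j t)) \<in> L1_loc"
    unfolding L1_loc_def set_integrable_def
  proof (intro CollectI allI)
    fix a' b' :: real
    have "{a'..b'} \<subseteq> {- max \<bar>a'\<bar> \<bar>b'\<bar>..max \<bar>a'\<bar> \<bar>b'\<bar>}"
      by auto
    then show "integrable lebesgue (\<lambda>t. indicator {a'..b'} t *\<^sub>R (w t * (\<Sum>j. a j t)))"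
      by (intro *[THEN conjunct1]) auto
  qed
  have "einterval (ereal s) (ereal t) \<subseteq> {- max \<bar>s\<bar> \<bar>t\<bar>..max \<bar>s\<bar> \<bar>t\<bar>}" for s t
    by (auto simp: einterval_def)
  then have "(\<lambda>j. LINT t:einterval (ereal s) (ereal t)|lebesgue. w t * a j t) sums
      (LINT t:einterval (ereal s) (ereal t)|lebesgue. w t * (\<Sum>j. a j t))" for s t
    by (intro *[THEN conjunct2]) auto
  then show "(\<lambda>j. primitive (\<lambda>t. w t * a j t) x) sums primitive (\<lambda>t. w t * (\<Sum>j. a j t)) x"
    unfolding primitive_def interval_lebesgue_integral_def by (auto intro!: sums_minus)
qed

text \<open>Each application of the recursion contributes one sign. Hence the half sum and half
  difference in \<open>biv_cosh\<close> and \<open>biv_sinh\<close> select the even and the odd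
  terms.\<close>

lemma iterated_integral_uminus:
  assumes u: "u \<in> L1_loc" and v: "v \<in> L1_loc"
  shows "iterated_integral j (\<lambda>t. - u t) (\<lambda>t. - v t) x = (-1) ^ j * iterated_integral j u v x"
proof (induction j arbitrary: x)
  case (Suc j)
  have "iterated_integral (Suc j) (\<lambda>t. - u t) (\<lambda>t. - v t) x =
      primitive (\<lambda>t. (-1) ^ Suc j * ((if odd (Suc j) then u t else v t) * iterated_integral j u v t)) x"
    unfolding iterated_integral_Suc[OF L1_loc_uminus[OF u] L1_loc_uminus[OF v]] Suc
    by (rule arg_cong2[of _ _ _ _ primitive]) auto
  also have "\<dots> = (-1) ^ Suc j * primitive (\<lambda>t. (if odd (Suc j) then u t else v t) * iterated_integral j u v t) x"
    unfolding primitive_def by (rule interval_lebesgue_integral_mult_right)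
  finally show ?case
    by (simp only: iterated_integral_Suc[OF u v])
qed simp

text \<open>The even terms (\<open>p\<close> false) form the series of \<open>biv_cosh\<close>, the
  odd ones that of \<open>biv_sinh\<close>. The Boolean index lets two series that feed each other
  be treated as one family, with zeros at the omitted indices.\<close>

definition parity_term :: "bool \<Rightarrow> (real \<Rightarrow> complex) \<Rightarrow> (real \<Rightarrow> complex) \<Rightarrow> nat \<Rightarrow> real \<Rightarrow> complex" where
  "parity_term p u v j x = (if odd j = p then iterated_integral j u v x else 0)"

lemma iterated_integral_summable_bound:
  assumes u: "u \<in> L1_loc" and v: "v \<in> L1_loc"
  shows "\<exists>c. summable c \<and> (\<forall>j t. \<bar>t\<bar> \<le> b \<longrightarrow> norm (iterated_integral j u v t) \<le> c j)"
proof -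
  define k where "k = (\<lambda>t. complex_of_real (norm (u t) + norm (v t)))"
  have k: "k \<in> L1_loc"
    using L1_loc_add[OF L1_loc_norm[OF u] L1_loc_norm[OF v]] by (simp add: k_def)
  obtain B where B: "0 < B" "\<And>x. x \<in> {-b..b} \<Longrightarrow> norm (primitive k x) \<le> B"
    using AC_loc_bounded[OF primitive_AC_loc[OF k]] by blast
  have "norm (iterated_integral j u v t) \<le> B ^ j / fact j" if "\<bar>t\<bar> \<le> b" for j t
  proof -
    have "norm (iterated_integral j u v t) \<le> norm (primitive k t) ^ j / fact j"
      unfolding k_def by (rule norm_iterated_integral_le[OF u v])
    also have "\<dots> \<le> B ^ j / fact j"
      using that by (intro divide_right_mono power_mono B) auto
    finally show ?thesis .
  qed
  then show ?thesis
    using summable_exp[of B] by (intro exI[of _ "\<lambda>j. B ^ j / fact j"]) (auto simp: field_simps)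
qed

lemma parity_term_sums:
  assumes u: "u \<in> L1_loc" and v: "v \<in> L1_loc"
  shows "(\<lambda>j. parity_term False u v j x) sums biv_cosh u v x"
    and "(\<lambda>j. parity_term True u v j x) sums biv_sinh u v x"
proof -
  let ?A = "\<lambda>j. iterated_integral j u v x"
  obtain c where c: "summable c" "\<And>j t. \<bar>t\<bar> \<le> \<bar>x\<bar> \<Longrightarrow> norm (iterated_integral j u v t) \<le> c j"
    using iterated_integral_summable_bound[OF u v, of "\<bar>x\<bar>"] by blast
  have "summable ?A"
    by (rule summable_comparison_test'[OF c(1)]) (use c(2) in auto)
  then have "summable (\<lambda>j. ?A (Suc j))"
    by (rule summable_Suc_iff[THEN iffD2])
  then have 1: "(\<lambda>j. ?A (Suc j)) sums (biv_exp u v x - 1)"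
    unfolding biv_exp_def add_diff_cancel_left' by (rule summable_sums)
  have "summable (\<lambda>j. (-1) ^ j * ?A j)"
    by (rule summable_comparison_test'[OF c(1)]) (use c(2) in \<open>auto simp: norm_mult norm_power\<close>)
  then have "summable (\<lambda>j. (-1) ^ Suc j * ?A (Suc j))"
    by (subst summable_Suc_iff[of "\<lambda>j. (-1) ^ j * ?A j"])
  then have 2: "(\<lambda>j. (-1) ^ Suc j * ?A (Suc j)) sums (biv_exp (\<lambda>t. - u t) (\<lambda>t. - v t) x - 1)"
    unfolding biv_exp_def iterated_integral_uminus[OF u v] add_diff_cancel_left' by (rule summable_sums)
  have "(\<lambda>j. (?A (Suc j) + (-1) ^ Suc j * ?A (Suc j)) / 2) sums (biv_cosh u v x - 1)"
    using sums_divide[OF sums_add[OF 1 2], of 2] by (simp add: biv_cosh_def field_simps)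
  moreover have "(?A (Suc j) + (-1) ^ Suc j * ?A (Suc j)) / 2 = parity_term False u v (Suc j) x" for j
    by (auto simp: parity_term_def)
  ultimately have "(\<lambda>j. parity_term False u v (Suc j) x) sums (biv_cosh u v x - 1)"
    by simp
  \<comment> \<open>The shift restores the term of index 0, which is the 1 split off in
    \<open>biv_exp\<close>; in the odd family that term is 0.\<close>
  from sums_Suc[OF this] show "(\<lambda>j. parity_term False u v j x) sums biv_cosh u v x"
    by (simp add: parity_term_def)
  have "(\<lambda>j. (?A (Suc j) - (-1) ^ Suc j * ?A (Suc j)) / 2) sums biv_sinh u v x"
    using sums_divide[OF sums_diff[OF 1 2], of 2] by (simp add: biv_sinh_def)
  moreover have "(?A (Suc j) - (-1) ^ Suc j * ?A (Suc j)) / 2 = parity_term True u v (Suc j) x" for j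
    by (auto simp: parity_term_def)
  ultimately have "(\<lambda>j. parity_term True u v (Suc j) x) sums biv_sinh u v x"
    by simp
  from sums_Suc[OF this] show "(\<lambda>j. parity_term True u v j x) sums biv_sinh u v x"
    by (simp add: parity_term_def)
qed

text \<open>Raising the index flips the parity, and the last factor of the alternating product is
  \<open>u\<close> exactly when the number of factors is odd.\<close>

lemma parity_term_Suc:
  assumes "u \<in> L1_loc" "v \<in> L1_loc"
  shows "parity_term p u v (Suc j) x = primitive (\<lambda>t. (if p then u t else v t) * parity_term (\<not> p) u v j t) x"
  using iterated_integral_Suc[OF assms, of j x] by (auto simp: parity_term_def)

text \<open>Summation of the recursion couples the two series into a pair of Volterra equations;
  \<open>of_bool\<close> is the term of index 0, which only the even series has.\<close>

lemma biv_integral_equation: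
  assumes u: "u \<in> L1_loc" and v: "v \<in> L1_loc"
  defines "E \<equiv> \<lambda>p. if p then biv_sinh u v else biv_cosh u v"
  defines "w \<equiv> \<lambda>p. if p then u else v"
  shows "(\<lambda>t. w p t * E (\<not> p) t) \<in> L1_loc"
    and "E p x = of_bool (\<not> p) + primitive (\<lambda>t. w p t * E (\<not> p) t) x"
proof -
  have s: "(\<lambda>j. parity_term p u v j x) sums E p x" for p x
    using parity_term_sums[OF u v] by (simp add: E_def)
  then have S: "(\<Sum>j. parity_term p u v j x) = E p x" for p x
    by (simp add: sums_iff)
  have w: "w p \<in> L1_loc"
    using u v by (simp add: w_def)
  have cont: "continuous_on UNIV (parity_term p u v j)" for p j
  proof (cases "odd j = p")
    case True
    then have "parity_term p u v j = iterated_integral j u v"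
      by (auto simp: parity_term_def)
    then show ?thesis
      by (simp add: AC_loc_continuous_on[OF iterated_integral_AC_loc[OF u v]])
  next
    case False
    then have "parity_term p u v j = (\<lambda>x. 0)"
      by (auto simp: parity_term_def)
    then show ?thesis
      by simp
  qed
  have bnd: "\<exists>c. summable c \<and> (\<forall>j t. \<bar>t\<bar> \<le> b \<longrightarrow> norm (parity_term p u v j t) \<le> c j)" for b p
  proof -
    obtain c where c: "summable c" "\<And>j t. \<bar>t\<bar> \<le> b \<Longrightarrow> norm (iterated_integral j u v t) \<le> c j"
      using iterated_integral_summable_bound[OF u v, of b] by blast
    show ?thesis
    proof (intro exI conjI allI impI)
      fix j t assume "\<bar>t\<bar> \<le> b"
      from c(2)[OF this, of j] show "norm (parity_term p u v j t) \<le> c j"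
        using norm_ge_zero[of "iterated_integral j u v t"] by (auto simp: parity_term_def simp del: norm_ge_zero)
    qed (rule c)
  qed
  show "(\<lambda>t. w p t * E (\<not> p) t) \<in> L1_loc"
    using primitive_suminf(1)[where a = "parity_term (\<not> p) u v" and w = "w p", OF w cont bnd] by (simp add: S)
  have "(\<lambda>j. parity_term p u v (Suc j) x) sums primitive (\<lambda>t. w p t * E (\<not> p) t) x"
    using primitive_suminf(2)[where a = "parity_term (\<not> p) u v" and w = "w p" and x = x, OF w cont bnd]
    by (simp add: S parity_term_Suc[OF u v] w_def if_distrib[of "\<lambda>f. f _"] cong: if_cong)
  from sums_Suc[OF this] show "E p x = of_bool (\<not> p) + primitive (\<lambda>t. w p t * E (\<not> p) t) x"
    using sums_unique2[OF s] by (auto simp: parity_term_def add.commute)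
qed

lemma
  assumes u: "u \<in> L1_loc" and v: "v \<in> L1_loc"
  shows biv_cosh_AC_loc: "biv_cosh u v \<in> AC_loc UNIV"
    and biv_cosh_derivative: "AE x in lebesgue. (biv_cosh u v has_vector_derivative v x * biv_sinh u v x) (at x)"
    and biv_cosh_0: "biv_cosh u v 0 = 1"
    and biv_sinh_AC_loc: "biv_sinh u v \<in> AC_loc UNIV"
    and biv_sinh_derivative: "AE x in lebesgue. (biv_sinh u v has_vector_derivative u x * biv_cosh u v x) (at x)"
    and biv_sinh_0: "biv_sinh u v 0 = 0"
proof -
  note L = biv_integral_equation(1)[OF u v] and I = biv_integral_equation(2)[OF u v]
  have Lc: "(\<lambda>t. v t * biv_sinh u v t) \<in> L1_loc" and Ls: "(\<lambda>t. u t * biv_cosh u v t) \<in> L1_loc"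
    using L[of False] L[of True] by simp_all
  have C: "biv_cosh u v = (\<lambda>x. 1 + primitive (\<lambda>t. v t * biv_sinh u v t) x)"
    and S: "biv_sinh u v = (\<lambda>x. primitive (\<lambda>t. u t * biv_cosh u v t) x)"
    by (rule ext, rule I[of False, simplified], rule ext, rule I[of True, simplified])
  show "biv_cosh u v \<in> AC_loc UNIV"
    by (subst C) (intro AC_loc_add AC_loc_const primitive_AC_loc Lc)
  show "biv_sinh u v \<in> AC_loc UNIV"
    by (subst S) (intro primitive_AC_loc Ls)
  show "biv_cosh u v 0 = 1" "biv_sinh u v 0 = 0"
    by (subst C, simp) (subst S, simp)
  show "AE x in lebesgue. (biv_cosh u v has_vector_derivative v x * biv_sinh u v x) (at x)"
    using primitive_has_vector_derivative_AE[OF Lc]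
  proof eventually_elim
    case (elim x)
    then show ?case
      by (subst C) (auto intro!: derivative_eq_intros)
  qed
  show "AE x in lebesgue. (biv_sinh u v has_vector_derivative u x * biv_cosh u v x) (at x)"
    using primitive_has_vector_derivative_AE[OF Ls]
  proof eventually_elim
    case (elim x)
    then show ?case
      by (subst S)
  qed
qed

subsection \<open>Stereographic projection\<close>

lemma vector3_decompose:
  "(vector [a, b, c] :: real^3) = a *\<^sub>R vector [1, 0, 0] + b *\<^sub>R vector [0, 1, 0] + c *\<^sub>R vector [0, 0, 1]"
  by (simp add: vec_eq_iff forall_3)

lemma AC_loc_vector3:
  assumes "a \<in> AC_loc UNIV" "b \<in> AC_loc UNIV" "c \<in> AC_loc UNIV"
  shows "(\<lambda>x. vector [a x, b x, c x] :: real^3) \<in> AC_loc UNIV"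
  by (subst vector3_decompose) (intro AC_loc_add AC_loc_scaleR AC_loc_const assms)

lemma stereographic_Fin:
  "stereographic (Fin z) $ 1 = 2 * Re z / ((cmod z)\<^sup>2 + 1)"
  "stereographic (Fin z) $ 2 = 2 * Im z / ((cmod z)\<^sup>2 + 1)"
  "stereographic (Fin z) $ 3 = ((cmod z)\<^sup>2 - 1) / ((cmod z)\<^sup>2 + 1)"
  by simp_all

lemma inner_real3: "(s :: real^3) \<bullet> t = s $ 1 * t $ 1 + s $ 2 * t $ 2 + s $ 3 * t $ 3"
  by (simp add: inner_vec_def sum_3)

lemma norm_stereographic: "norm (stereographic z) = 1"
proof (cases z)
  case (Fin w)
  define x where "x = Re w"
  define y where "y = Im w"
  define r where "r = (cmod w)\<^sup>2"
  let ?s = "stereographic (Fin w)"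
  have S: "?s $ 1 = 2 * x / (r + 1)" "?s $ 2 = 2 * y / (r + 1)" "?s $ 3 = (r - 1) / (r + 1)"
    by (simp_all only: stereographic_Fin x_def y_def r_def)
  have r: "r = x\<^sup>2 + y\<^sup>2"
    by (simp only: r_def x_def y_def cmod_power2)
  have "0 \<le> r"
    unfolding r by simp
  have *: "a / c * (a / c) + b / c * (b / c) + d / c * (d / c) = 1"
    if "c \<noteq> 0" "a * a + b * b + d * d = c * c" for a b c d :: real
    using that by (simp only: times_divide_times_eq add_divide_distrib[symmetric]) simp
  have "?s \<bullet> ?s = 1"
    unfolding inner_real3 S
  proof (rule *)
    show "2 * x * (2 * x) + 2 * y * (2 * y) + (r - 1) * (r - 1) = (r + 1) * (r + 1)"
      unfolding r by (simp add: power2_eq_square algebra_simps)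
  qed (use \<open>0 \<le> r\<close> in simp)
  then show ?thesis
    using Fin by (simp only: norm_eq_1)
next
  case Infty
  then show ?thesis
    by (simp add: norm_eq_1 inner_real3)
qed

lemma one_plus_mult_cnj: "1 + z * cnj z = complex_of_real ((cmod z)\<^sup>2 + 1)" "1 + z * cnj z \<noteq> 0"
proof -
  show 1: "1 + z * cnj z = complex_of_real ((cmod z)\<^sup>2 + 1)"
    by (simp only: of_real_add of_real_1 complex_norm_square add.commute[of 1])
  have "(cmod z)\<^sup>2 + 1 \<noteq> 0"
    using zero_le_power2[of "cmod z"] by linarith
  then show "1 + z * cnj z \<noteq> 0"
    by (simp only: 1 of_real_eq_0_iff) simp
qed

text \<open>For unit vectors the squared distance is 2 minus twice the inner product. Writing moduli
  as products with conjugates makes the right side accessible to the product and quotient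
  rules.\<close>

lemma chordal_distance:
  "complex_of_real ((norm (stereographic (Fin z) - stereographic (Fin w)))\<^sup>2) =
    4 * ((z - w) * cnj (z - w)) / ((1 + z * cnj z) * (1 + w * cnj w))"
proof -
  define x y x' y' where "x = Re z" and "y = Im z" and "x' = Re w" and "y' = Im w"
  define r where "r = (cmod z)\<^sup>2"
  define q where "q = (cmod w)\<^sup>2"
  let ?s = "stereographic (Fin z)" and ?t = "stereographic (Fin w)"
  have S: "?s $ 1 = 2 * x / (r + 1)" "?s $ 2 = 2 * y / (r + 1)" "?s $ 3 = (r - 1) / (r + 1)"
    and T: "?t $ 1 = 2 * x' / (q + 1)" "?t $ 2 = 2 * y' / (q + 1)" "?t $ 3 = (q - 1) / (q + 1)"
    by (simp_all only: stereographic_Fin x_def y_def r_def x'_def y'_def q_def)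
  have r: "r = x\<^sup>2 + y\<^sup>2" and q: "q = x'\<^sup>2 + y'\<^sup>2"
    by (simp_all only: r_def x_def y_def q_def x'_def y'_def cmod_power2)
  have "r + 1 \<noteq> 0" "q + 1 \<noteq> 0"
    unfolding r q using zero_le_power2[of x] zero_le_power2[of y] zero_le_power2[of x'] zero_le_power2[of y']
    by linarith+
  then have nz: "(r + 1) * (q + 1) \<noteq> 0"
    by simp
  have *: "(norm (a - b))\<^sup>2 = 2 - 2 * (a \<bullet> b)" if "norm a = 1" "norm b = 1" for a b :: "real^3"
    using that by (simp add: norm_eq_1 power2_norm_eq_inner inner_diff_left inner_diff_right inner_commute)
  have st: "?s \<bullet> ?t = (2 * x * (2 * x') + 2 * y * (2 * y') + (r - 1) * (q - 1)) / ((r + 1) * (q + 1))"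
    unfolding inner_real3 S T by (simp only: times_divide_times_eq add_divide_distrib)
  have "(norm (?s - ?t))\<^sup>2 = 2 - 2 * (?s \<bullet> ?t)"
    by (intro * norm_stereographic)
  also have "\<dots> = (2 * ((r + 1) * (q + 1)) - 2 * (2 * x * (2 * x') + 2 * y * (2 * y') + (r - 1) * (q - 1))) / ((r + 1) * (q + 1))"
    unfolding st using nz by (simp only: diff_divide_distrib times_divide_eq_right nonzero_mult_div_cancel_right simp_thms)
  also have "2 * ((r + 1) * (q + 1)) - 2 * (2 * x * (2 * x') + 2 * y * (2 * y') + (r - 1) * (q - 1)) = 4 * ((x - x')\<^sup>2 + (y - y')\<^sup>2)"
    unfolding r q by (simp add: power2_eq_square algebra_simps)
  also have "(x - x')\<^sup>2 + (y - y')\<^sup>2 = (cmod (z - w))\<^sup>2"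
    by (simp only: cmod_power2 minus_complex.sel x_def x'_def y_def y'_def)
  finally have X: "(norm (?s - ?t))\<^sup>2 = 4 * (cmod (z - w))\<^sup>2 / ((r + 1) * (q + 1))" .
  show ?thesis
    unfolding X complex_norm_square[symmetric] r_def q_def
    by (simp only: of_real_divide of_real_mult of_real_numeral of_real_add of_real_1 add.commute)
qed

text \<open>Two finite points with equal images have chordal distance 0, and a finite point never
  reaches the third coordinate 1 of the pole.\<close>

lemma inj_stereographic: "inj stereographic"
proof (rule injI)
  fix y z assume eq: "stereographic y = stereographic z"
  have 3: "stereographic (Fin w) \<noteq> stereographic Infty" for w
  proof
    assume "stereographic (Fin w) = stereographic Infty"
    then have "stereographic (Fin w) $ 3 = 1"
      by simp
    moreover have "(cmod w)\<^sup>2 + 1 > 0"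
      by (simp add: add_nonneg_pos)
    ultimately show False
      unfolding stereographic_Fin by (simp add: divide_eq_eq)
  qed
  show "y = z"
  proof (cases y; cases z)
    fix a b assume "y = Fin a" "z = Fin b"
    moreover from this have "4 * ((a - b) * cnj (a - b)) / ((1 + a * cnj a) * (1 + b * cnj b)) = 0"
      using eq by (simp only: chordal_distance[symmetric]) simp
    ultimately show ?thesis
      using one_plus_mult_cnj(2) by simp
  qed (use eq 3 in \<open>metis\<close>)+
qed

text \<open>In homogeneous coordinates the projection has no singularity at \<open>Q = 0\<close>:
  its denominator is the sum of the squared moduli, which vanishes only at a common zero. This
  carries absolute continuity across poles.\<close>

lemma stereographic_quotient:
  assumes "P \<noteq> 0 \<or> Q \<noteq> 0"
  shows "stereographic (if Q = 0 then Infty else Fin (P / Q)) =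
    inverse ((cmod P)\<^sup>2 + (cmod Q)\<^sup>2) *\<^sub>R
      vector [2 * Re (P * cnj Q), 2 * Im (P * cnj Q), (cmod P)\<^sup>2 - (cmod Q)\<^sup>2]"
proof (cases "Q = 0")
  case True
  then show ?thesis
    using assms by (simp add: vec_eq_iff forall_3)
next
  case False
  define r where "r = (cmod P)\<^sup>2"
  define q where "q = (cmod Q)\<^sup>2"
  have q: "q > 0" and r: "r \<ge> 0"
    using False by (simp_all add: q_def r_def)
  have "P / Q = P * cnj Q / complex_of_real q"
    unfolding q_def by (rule complex_div_cnj)
  then have "Re (P / Q) = Re (P * cnj Q) / q" "Im (P / Q) = Im (P * cnj Q) / q"
    by (simp_all only: Re_divide_of_real Im_divide_of_real)
  moreover have "(cmod (P / Q))\<^sup>2 = r / q"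
    by (simp add: r_def q_def norm_divide power_divide)
  moreover have e: "r / q + 1 = (r + q) / q" "r / q - 1 = (r - q) / q" and rq: "r + q \<noteq> 0"
    using q r by (simp_all add: add_divide_distrib diff_divide_distrib)
  moreover have "2 * (x / q) / ((r + q) / q) = inverse (r + q) * (2 * x)" for x
    using q rq by (simp add: divide_simps)
  moreover have "(r - q) / q / ((r + q) / q) = inverse (r + q) * (r - q)"
    using q rq by (simp add: divide_simps)
  ultimately show ?thesis
    using False unfolding vec_eq_iff forall_3 r_def[symmetric] q_def[symmetric]
    by (simp only: if_False stereographic_Fin vector_scaleR_component vector_3 real_scaleR_def simp_thms)
qed

lemma AC_loc_stereographic:
  assumes P: "P \<in> AC_loc UNIV" and Q: "Q \<in> AC_loc UNIV" and nz: "\<And>x. P x \<noteq> 0 \<or> Q x \<noteq> 0"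
  shows "(\<lambda>x. stereographic (if Q x = 0 then Infty else Fin (P x / Q x))) \<in> AC_loc (sphere 0 1)"
proof -
  have re: "(\<lambda>x. Re (y x)) \<in> AC_loc UNIV" and im: "(\<lambda>x. Im (y x)) \<in> AC_loc UNIV"
    and cj: "(\<lambda>x. cnj (y x)) \<in> AC_loc UNIV" if "y \<in> AC_loc UNIV" for y
    by (rule bounded_linear.AC_loc[OF bounded_linear_Re that], rule bounded_linear.AC_loc[OF bounded_linear_Im that],
        rule bounded_linear.AC_loc[OF bounded_linear_cnj that])
  have sq: "(\<lambda>x. (cmod (y x))\<^sup>2) \<in> AC_loc UNIV" if "y \<in> AC_loc UNIV" for y
  proof -
    have "(cmod z)\<^sup>2 = Re (z * cnj z)" for z
      unfolding complex_norm_square[symmetric] by (simp only: Re_complex_of_real)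
    then show ?thesis
      using re[OF AC_loc_mult[OF that cj[OF that]]] by simp
  qed
  have df: "(\<lambda>x. (cmod (P x))\<^sup>2 - (cmod (Q x))\<^sup>2) \<in> AC_loc UNIV"
    using AC_loc_add[OF sq[OF P] AC_loc_mult[OF AC_loc_const[of "-1"] sq[OF Q]]] by simp
  have "(\<lambda>x. inverse ((cmod (P x))\<^sup>2 + (cmod (Q x))\<^sup>2) *\<^sub>R
      (vector [2 * Re (P x * cnj (Q x)), 2 * Im (P x * cnj (Q x)), (cmod (P x))\<^sup>2 - (cmod (Q x))\<^sup>2] :: real^3)) \<in> AC_loc UNIV"
  proof (intro AC_loc_scaleR AC_loc_inverse AC_loc_vector3 AC_loc_add AC_loc_mult AC_loc_const re im cj sq df P Q)
    show "(cmod (P x))\<^sup>2 + (cmod (Q x))\<^sup>2 \<noteq> 0" for x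
      using nz[of x] by (simp add: add_nonneg_eq_0_iff)
  qed
  then have "(\<lambda>x. stereographic (if Q x = 0 then Infty else Fin (P x / Q x))) \<in> AC_loc UNIV"
    by (simp only: stereographic_quotient[OF nz])
  moreover have "range (\<lambda>x. stereographic (if Q x = 0 then Infty else Fin (P x / Q x))) \<subseteq> sphere 0 1"
    by (auto simp only: norm_stereographic mem_sphere_0)
  ultimately show ?thesis
    by (simp only: AC_loc_iff_range[of _ "sphere 0 1"])
qed

subsection \<open>Uniqueness of projective solutions\<close>

text \<open>For two solutions \<open>z\<close>, \<open>w\<close> the squared chordal distance \<open>D\<close> satisfies the linear equation
  \<open>D' = k D\<close> whose coefficient, a sum of one term for each solution, is the polynomial
  \<open>Re (f \<sigma> - g s\<^sub>3 - h cnj \<sigma>)\<close>, \<open>\<sigma> = s\<^sub>1 + \<i> s\<^sub>2\<close>, in the coordinates \<open>s\<close> of the point on the sphere.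
  This coefficient is locally integrable even across the poles of the solutions.\<close>

definition riccati_rate :: "complex \<Rightarrow> complex \<Rightarrow> complex \<Rightarrow> real^3 \<Rightarrow> complex" where
  "riccati_rate f g h s = complex_of_real
    (Re (Complex (s$1) (s$2) * f + of_real (- s$3) * g + - cnj (Complex (s$1) (s$2)) * h))"

text \<open>The right side, divided by \<open>1 + z * cnj z\<close>, is the share of
  \<open>z\<close> in the logarithmic derivative of the squared chordal distance: the first summand
  stems from its numerator, the subtracted one from the derivative of the factor
  \<open>1 + z * cnj z\<close> below.\<close>

lemma riccati_rate_Fin:
  fixes z f g h :: complex
  defines "d \<equiv> f * z\<^sup>2 + g * z + h"
  shows "riccati_rate f g h (stereographic (Fin z)) * (1 + z * cnj z) =
    (f * z + cnj f * cnj z + of_real (Re g)) * (1 + z * cnj z) - (d * cnj z + z * cnj d)"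
proof -
  define B where "B = 1 + z * cnj z"
  have B: "B \<noteq> 0" "B = of_real ((cmod z)\<^sup>2 + 1)"
    unfolding B_def by (rule one_plus_mult_cnj)+
  let ?s = "stereographic (Fin z)"
  define \<sigma> where "\<sigma> = Complex (?s$1) (?s$2)"
  define \<zeta> where "\<zeta> = complex_of_real (?s$3)"
  have "\<sigma> = 2 * z / B"
    unfolding stereographic_Fin B(2) \<sigma>_def by (simp add: complex_eq_iff)
  then have 1: "\<sigma> * B = 2 * z"
    using B(1) by simp
  have "\<zeta> = (of_real ((cmod z)\<^sup>2) - 1) / B"
    unfolding stereographic_Fin B(2) \<zeta>_def by (simp only: of_real_divide of_real_diff of_real_1)
  then have 2: "\<zeta> * B = z * cnj z - 1"
    using B(1) by (simp only: complex_norm_square) simp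
  have "cnj B = B"
    by (simp add: B_def)
  then have 3: "cnj \<sigma> * B = 2 * cnj z"
    using arg_cong[OF 1, of cnj] by simp
  have re: "2 * complex_of_real (Re q) = q + cnj q" for q
    by (simp add: complex_eq_iff)
  have "2 * riccati_rate f g h ?s = (\<sigma> * f + - \<zeta> * g + - cnj \<sigma> * h) + (cnj \<sigma> * cnj f + - \<zeta> * cnj g + - \<sigma> * cnj h)"
    unfolding riccati_rate_def \<sigma>_def[symmetric] of_real_minus \<zeta>_def[symmetric] re
    by (simp add: \<zeta>_def)
  then have "2 * (riccati_rate f g h ?s * B) =
      ((\<sigma> * f + - \<zeta> * g + - cnj \<sigma> * h) + (cnj \<sigma> * cnj f + - \<zeta> * cnj g + - \<sigma> * cnj h)) * B"
    by (simp only: mult.assoc[symmetric])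
  also have "\<dots> = (\<sigma> * B) * f - (\<zeta> * B) * g - (cnj \<sigma> * B) * h
      + (cnj \<sigma> * B) * cnj f - (\<zeta> * B) * cnj g - (\<sigma> * B) * cnj h"
  proof -
    have "((s * f + - t * g + - c * h) + (c * f' + - t * g' + - s * h')) * b =
      (s * b) * f - (t * b) * g - (c * b) * h + (c * b) * f' - (t * b) * g' - (s * b) * h'"
      for s t c b f g h f' g' h' :: complex
      by (simp add: algebra_simps)
    then show ?thesis .
  qed
  also have "\<dots> = 2 * ((f * z + cnj f * cnj z + of_real (Re g)) * (1 + z * cnj z) - (d * cnj z + z * cnj d))"
  proof -
    \<comment> \<open>Conjugates become independent variables, which leaves a polynomial identity;
      the only relation to be kept is that between \<open>g\<close>, its conjugate and its real
      part.\<close>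
    have "2 * z * f - (z * c - 1) * g - 2 * c * h + 2 * c * f' - (z * c - 1) * g' - 2 * z * h' =
      2 * ((f * z + f' * c + \<gamma>) * (1 + z * c) - ((f * z\<^sup>2 + g * z + h) * c + z * (f' * c\<^sup>2 + g' * c + h')))"
      if "2 * \<gamma> = g + g'" for z c f g h f' g' h' \<gamma> :: complex
      using that by algebra
    from this[OF re] show ?thesis
      unfolding 1 2 3 d_def complex_cnj_add complex_cnj_mult complex_cnj_power .
  qed
  finally show ?thesis
    unfolding B_def by (simp only: mult_cancel_left) simp
qed

lemma has_vector_derivative_divide_complex:
  fixes A B :: "real \<Rightarrow> complex"
  assumes A: "(A has_vector_derivative A') (at x)" and B: "(B has_vector_derivative B') (at x)" and nz: "B x \<noteq> 0"
  shows "((\<lambda>t. A t / B t) has_vector_derivative (A' * B x - A x * B') / (B x * B x)) (at x)"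
proof -
  have "((\<lambda>t. inverse (B t)) has_vector_derivative B' * (- (inverse (B x) * inverse (B x)))) (at x)"
    using field_vector_diff_chain_at[OF B DERIV_inverse[OF nz]] by (simp add: o_def power2_eq_square)
  from has_vector_derivative_mult[OF A this]
  have "((\<lambda>t. A t * inverse (B t)) has_vector_derivative
      A x * (B' * (- (inverse (B x) * inverse (B x)))) + A' * inverse (B x)) (at x)" .
  moreover have "A x * (B' * (- (inverse (B x) * inverse (B x)))) + A' * inverse (B x) = (A' * B x - A x * B') / (B x * B x)"
    using nz by (simp add: field_simps)
  ultimately show ?thesis
    by (simp add: divide_inverse)
qed

text \<open>The difference of the two Riccati right-hand sides is
  \<open>(z - w) * (f * (z + w) + g)\<close>, so the numerator of the chordal distance already obeys
  a linear equation, and its coefficient splits into a part for \<open>z\<close> and a part for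
  \<open>w\<close>. The quotient rule completes each part to a rate.\<close>

lemma chordal_distance_derivative:
  fixes f g h :: complex and z w :: "real \<Rightarrow> complex"
  assumes z: "(z has_vector_derivative f * (z x)\<^sup>2 + g * z x + h) (at x)"
    and w: "(w has_vector_derivative f * (w x)\<^sup>2 + g * w x + h) (at x)"
  defines "D \<equiv> \<lambda>t. complex_of_real ((norm (stereographic (Fin (z t)) - stereographic (Fin (w t))))\<^sup>2)"
  shows "(D has_vector_derivative D x *
    (riccati_rate f g h (stereographic (Fin (z x))) + riccati_rate f g h (stereographic (Fin (w x))))) (at x)"
proof -
  let ?d = "\<lambda>z. f * z\<^sup>2 + g * z + h"
  let ?B = "\<lambda>z. 1 + z * cnj z" and ?B' = "\<lambda>z. ?d z * cnj z + z * cnj (?d z)"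
  let ?A = "\<lambda>z w. 4 * ((z - w) * cnj (z - w))"
  let ?A' = "4 * ((?d (z x) - ?d (w x)) * cnj (z x - w x) + (z x - w x) * cnj (?d (z x) - ?d (w x)))"
  let ?r = "\<lambda>z. riccati_rate f g h (stereographic (Fin z))"
  let ?e = "\<lambda>z. f * z + cnj f * cnj z + of_real (Re g)"
  have D: "D = (\<lambda>t. ?A (z t) (w t) / (?B (z t) * ?B (w t)))"
    unfolding D_def chordal_distance ..
  have dB: "((\<lambda>t. ?B (y t)) has_vector_derivative ?B' (y x)) (at x)"
    if "(y has_vector_derivative ?d (y x)) (at x)" for y
    using has_vector_derivative_add[OF has_vector_derivative_const[of 1]
        has_vector_derivative_mult[OF that has_vector_derivative_cnj[OF that]]]
    by (simp only: add_0 add.commute)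
  have dA: "((\<lambda>t. ?A (z t) (w t)) has_vector_derivative ?A') (at x)"
    using has_vector_derivative_mult[OF has_vector_derivative_const has_vector_derivative_mult[OF has_vector_derivative_diff[OF z w]
          has_vector_derivative_cnj[OF has_vector_derivative_diff[OF z w]]], of 4]
    by (simp only: mult_zero_left add_0_right add_0_left add.commute)
  have A': "?A' = ?A (z x) (w x) * (?e (z x) + ?e (w x))"
  proof -
    have "4 * (((f * z\<^sup>2 + g * z + h) - (f * w\<^sup>2 + g * w + h)) * (c - v) +
        (z - w) * ((f' * c\<^sup>2 + g' * c + h') - (f' * v\<^sup>2 + g' * v + h'))) =
      4 * ((z - w) * (c - v)) * ((f * z + f' * c + \<gamma>) + (f * w + f' * v + \<gamma>))"
      if "2 * \<gamma> = g + g'" for z w c v f g h f' g' h' \<gamma> :: complex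
      using that by algebra
    moreover have "2 * complex_of_real (Re g) = g + cnj g"
      by (simp add: complex_eq_iff)
    ultimately show ?thesis
      unfolding complex_cnj_add complex_cnj_mult complex_cnj_power complex_cnj_diff by blast
  qed
  have "(D has_vector_derivative (?A' * (?B (z x) * ?B (w x)) -
      ?A (z x) (w x) * (?B (z x) * ?B' (w x) + ?B' (z x) * ?B (w x))) /
      ((?B (z x) * ?B (w x)) * (?B (z x) * ?B (w x)))) (at x)"
    unfolding D
    by (rule has_vector_derivative_divide_complex[OF dA has_vector_derivative_mult[OF dB[OF z] dB[OF w]]])
      (use one_plus_mult_cnj(2) in simp)
  moreover have "?A' * (?B (z x) * ?B (w x)) - ?A (z x) (w x) * (?B (z x) * ?B' (w x) + ?B' (z x) * ?B (w x)) =
      ?A (z x) (w x) * ((?e (z x) * ?B (z x) - ?B' (z x)) * ?B (w x) + (?e (w x) * ?B (w x) - ?B' (w x)) * ?B (z x))"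
  proof -
    have "(a * (e1 + e2)) * (b1 * b2) - a * (b1 * c2 + c1 * b2) = a * ((e1 * b1 - c1) * b2 + (e2 * b2 - c2) * b1)"
      for a e1 e2 b1 b2 c1 c2 :: complex
      by (simp add: algebra_simps)
    then show ?thesis
      unfolding A' .
  qed
  moreover have "\<dots> = ?A (z x) (w x) * ((?r (z x) + ?r (w x)) * (?B (z x) * ?B (w x)))"
  proof -
    have "a * (r1 * b1 * b2 + r2 * b2 * b1) = a * ((r1 + r2) * (b1 * b2))" for a b1 b2 r1 r2 :: complex
      by (simp add: algebra_simps)
    then show ?thesis
      unfolding riccati_rate_Fin[symmetric] .
  qed
  ultimately have DD: "(D has_vector_derivative (?A (z x) (w x) * ((?r (z x) + ?r (w x)) * (?B (z x) * ?B (w x)))) /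
      ((?B (z x) * ?B (w x)) * (?B (z x) * ?B (w x)))) (at x)"
    by (simp only:)
  have *: "(a * (b * c)) / (c * c) = a / c * b" if "c \<noteq> 0" for a b c :: complex
    using that by simp
  have "?B (z x) * ?B (w x) \<noteq> 0"
    using one_plus_mult_cnj(2) by simp
  then show ?thesis
    using DD unfolding *[OF \<open>?B (z x) * ?B (w x) \<noteq> 0\<close>] D by (simp only:)
qed

text \<open>The integrating factor \<open>exp (- primitive k x)\<close> never vanishes and turns
  \<open>D\<close> into a constant.\<close>

lemma AC_loc_linear_ode_zero:
  fixes D :: "real \<Rightarrow> complex"
  assumes D: "D \<in> AC_loc UNIV" and k: "k \<in> L1_loc"
    and ae: "AE x in lebesgue. (D has_vector_derivative D x * k x) (at x)" and "D 0 = 0"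
  shows "D x = 0"
proof -
  let ?E = "\<lambda>x. exp (- primitive k x)"
  have "(\<lambda>x. D x * ?E x) \<in> AC_loc UNIV"
    by (intro AC_loc_mult D AC_loc_exp bounded_linear.AC_loc[OF bounded_linear_minus[OF bounded_linear_ident]] primitive_AC_loc k)
  moreover have "AE x in lebesgue. ((\<lambda>x. D x * ?E x) has_vector_derivative 0) (at x)"
    using ae primitive_has_vector_derivative_AE[OF k]
  proof eventually_elim
    case (elim x)
    have "(?E has_vector_derivative - k x * ?E x) (at x)"
      using field_vector_diff_chain_at[OF has_vector_derivative_minus[OF elim(2)] DERIV_exp] by (simp add: o_def)
    from has_vector_derivative_mult[OF elim(1) this] show ?case
      by (simp add: algebra_simps)
  qed
  ultimately have "D x * ?E x = D 0 * ?E 0"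
    by (rule AC_loc_zero_derivative_imp_const)
  then show ?thesis
    using \<open>D 0 = 0\<close> by simp
qed

lemma projective_solution_unique:
  assumes f: "f \<in> L1_loc" and g: "g \<in> L1_loc" and h: "h \<in> L1_loc"
    and y1: "projective_solution f g h y0 y1" and y2: "projective_solution f g h y0 y2"
  shows "y1 = y2"
proof
  fix x
  define s where "s = stereographic \<circ> y1"
  define t where "t = stereographic \<circ> y2"
  have s: "s \<in> AC_loc UNIV" and t: "t \<in> AC_loc UNIV"
    using y1 y2 AC_loc_iff_range[of _ "sphere 0 1"] unfolding projective_solution_def s_def t_def by blast+
  define D where "D x = complex_of_real ((norm (s x - t x))\<^sup>2)" for x
  define k where "k x = riccati_rate (f x) (g x) (h x) (s x) + riccati_rate (f x) (g x) (h x) (t x)" for x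
  have "(\<lambda>x. s x - t x) \<in> AC_loc UNIV"
    using AC_loc_add[OF s bounded_linear.AC_loc[OF bounded_linear_minus[OF bounded_linear_ident] t]] by simp
  then have D: "D \<in> AC_loc UNIV"
    unfolding D_def power2_norm_eq_inner
    by (intro bounded_linear.AC_loc[OF bounded_linear_of_real] bounded_bilinear.AC_loc[OF bounded_bilinear_inner])
  have rate: "(\<lambda>x. riccati_rate (f x) (g x) (h x) (r x)) \<in> L1_loc" if r: "r \<in> AC_loc UNIV" for r
  proof -
    have c: "continuous_on UNIV (\<lambda>x. Complex (r x $ 1) (r x $ 2))"
      unfolding complex_eq
      by (intro continuous_intros AC_loc_continuous_on[OF r])
    have "(\<lambda>x. Complex (r x $ 1) (r x $ 2) * f x + of_real (- r x $ 3) * g x + - cnj (Complex (r x $ 1) (r x $ 2)) * h x) \<in> L1_loc"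
      by (intro L1_loc_add L1_loc_continuous_mult f g h c continuous_intros AC_loc_continuous_on[OF r])
    then show ?thesis
      unfolding riccati_rate_def
      by (rule L1_loc_linear) (rule bounded_linear_compose[OF bounded_linear_of_real bounded_linear_Re])
  qed
  have k: "k \<in> L1_loc"
    unfolding k_def by (intro L1_loc_add rate s t)
  have ae: "AE x in lebesgue. (D has_vector_derivative D x * k x) (at x)"
  proof -
    have "AE x in lebesgue. \<exists>z. y1 x = Fin z \<and> has_sphere_derivative y1 (f x * z\<^sup>2 + g x * z + h x) x"
      "AE x in lebesgue. \<exists>z. y2 x = Fin z \<and> has_sphere_derivative y2 (f x * z\<^sup>2 + g x * z + h x) x"
      using y1 y2 unfolding projective_solution_def riccati_ae_def by blast+
    then show ?thesis
    proof eventually_elim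
      case (elim x)
      obtain z1 w1 where 1: "y1 x = Fin z1" "\<forall>\<^sub>F t in nhds x. y1 t = Fin (w1 t)"
        "(w1 has_vector_derivative f x * z1\<^sup>2 + g x * z1 + h x) (at x)"
        using elim(1) unfolding has_sphere_derivative_def by blast
      obtain z2 w2 where 2: "y2 x = Fin z2" "\<forall>\<^sub>F t in nhds x. y2 t = Fin (w2 t)"
        "(w2 has_vector_derivative f x * z2\<^sup>2 + g x * z2 + h x) (at x)"
        using elim(2) unfolding has_sphere_derivative_def by blast
      have w: "w1 x = z1" "w2 x = z2"
        using eventually_nhds_x_imp_x[OF 1(2)] eventually_nhds_x_imp_x[OF 2(2)] 1(1) 2(1) by simp_all
      let ?D = "\<lambda>t. complex_of_real ((norm (stereographic (Fin (w1 t)) - stereographic (Fin (w2 t))))\<^sup>2)"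
      \<comment> \<open>Both solutions are finite in a whole neighbourhood of \<open>x\<close>, so
        \<open>D\<close> coincides there with the expression in affine coordinates and has the same
        derivative at \<open>x\<close>.\<close>
      have ev: "\<forall>\<^sub>F t in nhds x. ?D t = D t"
        using 1(2) 2(2) by eventually_elim (simp add: D_def s_def t_def del: stereographic.simps)
      have "(?D has_vector_derivative ?D x *
          (riccati_rate (f x) (g x) (h x) (stereographic (Fin (w1 x))) + riccati_rate (f x) (g x) (h x) (stereographic (Fin (w2 x))))) (at x)"
        by (rule chordal_distance_derivative) (use 1(3) 2(3) w in simp_all)
      then have "(?D has_vector_derivative D x * k x) (at x)"
        using eventually_nhds_x_imp_x[OF ev] by (simp add: k_def s_def t_def w 1(1) 2(1) del: stereographic.simps)
      moreover have "(?D has_vector_derivative D x * k x) (at x) = (D has_vector_derivative D x * k x) (at x)"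
        using ev eventually_nhds_x_imp_x[OF ev] by (intro has_vector_derivative_cong_ev) (auto elim: eventually_mono)
      ultimately show ?case
        by (rule iffD1[rotated])
    qed
  qed
  have "D 0 = 0"
    using y1 y2 by (simp add: D_def s_def t_def projective_solution_def)
  with D k ae have "D x = 0"
    by (rule AC_loc_linear_ode_zero)
  then have "stereographic (y1 x) = stereographic (y2 x)"
    by (simp add: D_def s_def t_def)
  then show "y1 x = y2 x"
    by (rule injD[OF inj_stereographic])
qed

text \<open>A finite function is a quotient with denominator 1, so its image on the sphere is
  locally absolutely continuous. Uniqueness on the sphere thereby extends to standard
  solutions.\<close>

lemma standard_imp_projective:
  assumes "standard_solution f g h y0 w"
  shows "projective_solution f g h y0 (Fin \<circ> w)"
proof -
  have w: "w \<in> AC_loc UNIV" and ae: "AE x in lebesgue. (w has_vector_derivative f x * (w x)\<^sup>2 + g x * w x + h x) (at x)"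
    and "w 0 = y0"
    using assms by (auto simp: standard_solution_def)
  have "stereographic \<circ> (Fin \<circ> w) \<in> AC_loc (sphere 0 1)"
    using AC_loc_stereographic[OF w AC_loc_const[of 1]] by (simp add: o_def del: stereographic.simps)
  moreover have "riccati_ae f g h (Fin \<circ> w)"
    unfolding riccati_ae_def using ae
  proof eventually_elim
    case (elim x)
    then show ?case
      unfolding has_sphere_derivative_def by (intro exI[of _ "w x"] conjI exI[of _ w]) auto
  qed
  ultimately show ?thesis
    using \<open>w 0 = y0\<close> by (simp add: projective_solution_def)
qed

subsection \<open>The explicit solution\<close>

text \<open>Each isolated point is cut out of the set by some basic open set, which determines the
  point; there are only countably many basic sets.\<close>

lemma countable_isolated_points:
  fixes Z :: "'a::second_countable_topology set"
  shows "countable {x. x isolated_in Z}"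
proof -
  obtain B :: "'a set set" where B: "countable B" "topological_basis B"
    using ex_countable_basis by blast
  have "{x. x isolated_in Z} \<subseteq> (\<lambda>b. the_elem (b \<inter> Z)) ` B"
  proof
    fix x assume "x \<in> {x. x isolated_in Z}"
    then obtain T where T: "open T" "T \<inter> Z = {x}"
      by (auto simp: isolated_in_def)
    then obtain b where "b \<in> B" "x \<in> b" "b \<subseteq> T"
      using topological_basisE[OF B(2), of T x] by blast
    moreover from this T have "b \<inter> Z = {x}"
      by blast
    ultimately show "x \<in> (\<lambda>b. the_elem (b \<inter> Z)) ` B"
      by (metis image_eqI the_elem_eq)
  qed
  then show ?thesis
    using B(1) by (meson countable_image countable_subset)
qed

lemma nonzero_derivative_isolated_zero:
  fixes q :: "real \<Rightarrow> 'a::real_normed_vector"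
  assumes d: "(q has_vector_derivative d) (at x)" and "d \<noteq> 0" "q x = 0"
  shows "x isolated_in {x. q x = 0}"
proof -
  \<comment> \<open>A tolerance below \<open>norm d\<close> suffices: at a second zero
    \<open>t\<close> within reach the linear term alone, of size
    \<open>\<bar>t - x\<bar> * norm d\<close>, would have to stay within the error.\<close>
  have e: "norm d / 2 > 0"
    using \<open>d \<noteq> 0\<close> by simp
  obtain r where r: "r > 0" "\<And>t. norm (t - x) < r \<Longrightarrow> norm (q t - q x - (t - x) *\<^sub>R d) \<le> norm d / 2 * norm (t - x)"
    using d e unfolding has_vector_derivative_def has_derivative_at_alt by blast
  have "t = x" if "q t = 0" "dist x t < r" for t
  proof (rule ccontr)
    assume "t \<noteq> x"
    have "\<bar>t - x\<bar> * norm d \<le> norm d / 2 * \<bar>t - x\<bar>"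
      using r(2)[of t] that \<open>q x = 0\<close> by (simp add: dist_real_def abs_minus_commute)
    moreover have "\<bar>t - x\<bar> * norm d > 0"
      using \<open>t \<noteq> x\<close> \<open>d \<noteq> 0\<close> by simp
    ultimately show False
      by (simp add: mult.commute)
  qed
  then show ?thesis
    using \<open>r > 0\<close> \<open>q x = 0\<close> unfolding isolated_in_dist_Ex_iff by blast
qed

section \<open>Numerator and denominator as solutions of a linear system\<close>

locale riccati =
  fixes f g h F H :: "real \<Rightarrow> complex" and y0 :: complex
  assumes f: "f \<in> L1_loc" and g: "g \<in> L1_loc" and h: "h \<in> L1_loc"
    and F: "F = (\<lambda>x. - exp (primitive g x) * f x)"
    and H: "H = (\<lambda>x. exp (- primitive g x) * h x)"
begin

lemma continuous_exp_primitive: "continuous_on UNIV (\<lambda>x. exp (c * primitive g x))"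
  by (intro continuous_intros AC_loc_continuous_on primitive_AC_loc g)

lemma F_L1: "F \<in> L1_loc" and H_L1: "H \<in> L1_loc"
proof -
  have "(\<lambda>x. exp (1 * primitive g x) * (- f x)) \<in> L1_loc"
    by (intro L1_loc_continuous_mult continuous_exp_primitive L1_loc_uminus f)
  then show "F \<in> L1_loc"
    by (simp add: F)
  have "(\<lambda>x. exp (- 1 * primitive g x) * h x) \<in> L1_loc"
    by (intro L1_loc_continuous_mult continuous_exp_primitive h)
  then show "H \<in> L1_loc"
    by (simp add: H)
qed

text \<open>Moving both half exponentials of the matrix into one factor on the numerator removes
  \<open>g\<close> from the equation for the denominator.\<close>

definition num :: "real \<Rightarrow> complex" where
  "num x = exp (primitive g x) * (y0 * biv_cosh F H x + biv_sinh H F x)"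

definition den :: "real \<Rightarrow> complex" where
  "den x = y0 * biv_sinh F H x + biv_cosh H F x"

definition sol :: "real \<Rightarrow> riemann_sphere" where
  "sol x = (if den x = 0 then Infty else Fin (num x / den x))"

lemmas biv_AC_loc = biv_cosh_AC_loc[OF F_L1 H_L1] biv_sinh_AC_loc[OF F_L1 H_L1]
  biv_cosh_AC_loc[OF H_L1 F_L1] biv_sinh_AC_loc[OF H_L1 F_L1]

lemmas biv_derivative = biv_cosh_derivative[OF F_L1 H_L1] biv_sinh_derivative[OF F_L1 H_L1]
  biv_cosh_derivative[OF H_L1 F_L1] biv_sinh_derivative[OF H_L1 F_L1]

lemmas biv_0 = biv_cosh_0[OF F_L1 H_L1] biv_sinh_0[OF F_L1 H_L1]
  biv_cosh_0[OF H_L1 F_L1] biv_sinh_0[OF H_L1 F_L1]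

lemma num_AC_loc: "num \<in> AC_loc UNIV" and den_AC_loc: "den \<in> AC_loc UNIV"
  unfolding num_def[abs_def] den_def[abs_def]
  by (intro AC_loc_mult AC_loc_add AC_loc_exp AC_loc_const biv_AC_loc primitive_AC_loc g)+

text \<open>Both products have the derivative \<open>H S\<^sub>F\<^sub>,\<^sub>H
  C\<^sub>H\<^sub>,\<^sub>F + F C\<^sub>F\<^sub>,\<^sub>H S\<^sub>H\<^sub>,\<^sub>F\<close> almost
  everywhere, so their difference keeps its value at 0.\<close>

lemma determinant: "biv_cosh F H x * biv_cosh H F x - biv_sinh F H x * biv_sinh H F x = 1"
proof -
  let ?d = "\<lambda>x. biv_cosh F H x * biv_cosh H F x + (-1) * (biv_sinh F H x * biv_sinh H F x)"
  have "?d \<in> AC_loc UNIV"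
    by (intro AC_loc_mult AC_loc_add AC_loc_const biv_AC_loc)
  moreover have "AE x in lebesgue. (?d has_vector_derivative 0) (at x)"
    using biv_derivative
  proof eventually_elim
    case (elim x)
    show ?case
      using has_vector_derivative_diff[OF has_vector_derivative_mult[OF elim(1,3)] has_vector_derivative_mult[OF elim(2,4)]]
      by (simp add: algebra_simps)
  qed
  ultimately have "?d x = ?d 0"
    by (rule AC_loc_zero_derivative_imp_const)
  then show ?thesis
    by (simp add: biv_0)
qed

lemma num_den_nonzero: "num x \<noteq> 0 \<or> den x \<noteq> 0"
proof (rule ccontr)
  assume "\<not> ?thesis"
  then have p: "y0 * biv_cosh F H x + biv_sinh H F x = 0" and q: "y0 * biv_sinh F H x + biv_cosh H F x = 0"
    by (simp_all add: num_def den_def)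
  have "biv_cosh F H x * biv_cosh H F x - biv_sinh F H x * biv_sinh H F x = 0"
    using p q by algebra
  then show False
    by (simp add: determinant)
qed

text \<open>The exponentials in \<open>F\<close> and \<open>H\<close> are made for this: the factor
  of \<open>num\<close> cancels the one in \<open>H\<close> and leaves \<open>h\<close>, while the
  one in \<open>F\<close> is absorbed into \<open>num\<close>.\<close>

lemma num_den_derivative:
  "AE x in lebesgue. (num has_vector_derivative g x * num x + h x * den x) (at x) \<and>
    (den has_vector_derivative - f x * num x) (at x)"
  using biv_derivative primitive_has_vector_derivative_AE[OF g]
proof eventually_elim
  case (elim x)
  have e: "((\<lambda>x. exp (primitive g x)) has_vector_derivative g x * exp (primitive g x)) (at x)"
    using field_vector_diff_chain_at[OF elim(5) DERIV_exp] by (simp add: o_def)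
  have c: "((\<lambda>x. y0 * u x) has_vector_derivative y0 * u') (at x)" if "(u has_vector_derivative u') (at x)" for u u'
    using has_vector_derivative_mult[OF has_vector_derivative_const that, of y0] by simp
  have 1: "exp (primitive g x) * H x = h x"
    by (simp add: H exp_minus)
  have "(num has_vector_derivative exp (primitive g x) * (y0 * (H x * biv_sinh F H x) + H x * biv_cosh H F x)
      + g x * exp (primitive g x) * (y0 * biv_cosh F H x + biv_sinh H F x)) (at x)"
    unfolding num_def[abs_def] by (rule has_vector_derivative_mult[OF e has_vector_derivative_add[OF c[OF elim(1)] elim(4)]])
  also have "exp (primitive g x) * (y0 * (H x * biv_sinh F H x) + H x * biv_cosh H F x)
      + g x * exp (primitive g x) * (y0 * biv_cosh F H x + biv_sinh H F x) = g x * num x + h x * den x"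
    unfolding 1[symmetric] num_def den_def by (simp add: algebra_simps)
  finally have n: "(num has_vector_derivative g x * num x + h x * den x) (at x)" .
  have "(den has_vector_derivative y0 * (F x * biv_cosh F H x) + F x * biv_sinh H F x) (at x)"
    unfolding den_def[abs_def] by (rule has_vector_derivative_add[OF c[OF elim(2)] elim(3)])
  also have "y0 * (F x * biv_cosh F H x) + F x * biv_sinh H F x = - f x * num x"
    unfolding num_def by (simp add: F algebra_simps)
  finally show ?case
    using n by blast
qed

lemma quotient_derivative:
  assumes "(num has_vector_derivative g x * num x + h x * den x) (at x)"
    and "(den has_vector_derivative - f x * num x) (at x)" and nz: "den x \<noteq> 0"
  shows "((\<lambda>x. num x / den x) has_vector_derivative f x * (num x / den x)\<^sup>2 + g x * (num x / den x) + h x) (at x)"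
proof -
  have "((g x * num x + h x * den x) * den x - num x * (- f x * num x)) / (den x * den x) =
      f x * (num x / den x)\<^sup>2 + g x * (num x / den x) + h x"
    using nz by (simp add: field_simps power2_eq_square)
  with has_vector_derivative_divide_complex[OF assms] show ?thesis
    by simp
qed

lemma quotient_0: "den 0 = 1" "num 0 = y0"
  by (simp_all add: num_def den_def biv_0)

lemma stereographic_sol_AC_loc: "stereographic \<circ> sol \<in> AC_loc (sphere 0 1)"
  unfolding o_def sol_def by (rule AC_loc_stereographic[OF num_AC_loc den_AC_loc num_den_nonzero])

lemma standard_solution_quotient:
  assumes nz: "\<And>x. den x \<noteq> 0"
  shows "standard_solution f g h y0 (\<lambda>x. num x / den x)"
  unfolding standard_solution_def
proof (intro conjI)
  show "(\<lambda>x. num x / den x) \<in> AC_loc UNIV"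
    unfolding divide_inverse by (intro AC_loc_mult AC_loc_inverse num_AC_loc den_AC_loc nz)
  show "AE x in lebesgue. ((\<lambda>x. num x / den x) has_vector_derivative
      f x * (num x / den x)\<^sup>2 + g x * (num x / den x) + h x) (at x)"
    using num_den_derivative
  proof eventually_elim
    case (elim x)
    show ?case
      by (rule quotient_derivative[OF conjunct1[OF elim] conjunct2[OF elim] nz])
  qed
qed (simp add: quotient_0)

text \<open>At almost every zero of the denominator its derivative \<open>- f num\<close> does not vanish, so that almost
  every zero is isolated, and the isolated zeros are countable.\<close>

lemma den_nonzero_AE:
  assumes "{x. f x = 0} \<in> null_sets lebesgue"
  shows "AE x in lebesgue. den x \<noteq> 0"
proof -
  have "{x. x isolated_in {x. den x = 0}} \<in> null_sets lebesgue"
    by (intro null_sets_completionI countable_imp_null_set_lborel countable_isolated_points)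
  then have "AE x in lebesgue. \<not> x isolated_in {x. den x = 0}"
    by (auto dest: AE_not_in)
  moreover have "AE x in lebesgue. f x \<noteq> 0"
    using AE_not_in[OF assms] by simp
  ultimately show ?thesis
    using num_den_derivative
  proof eventually_elim
    case (elim x)
    show ?case
    proof
      assume "den x = 0"
      then have "- f x * num x \<noteq> 0"
        using elim(2) num_den_nonzero[of x] by simp
      then show False
        using nonzero_derivative_isolated_zero[OF conjunct2[OF elim(3)] _ \<open>den x = 0\<close>] elim(1) by blast
    qed
  qed
qed

text \<open>\<open>has_sphere_derivative\<close> demands finiteness in a whole neighbourhood;
  continuity of \<open>den\<close> extends its nonvanishing from the point to such a
  neighbourhood.\<close>

lemma riccati_ae_sol:
  assumes "{x. f x = 0} \<in> null_sets lebesgue"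
  shows "riccati_ae f g h sol"
  unfolding riccati_ae_def using den_nonzero_AE[OF assms] num_den_derivative
proof eventually_elim
  case (elim x)
  have "isCont den x"
    using AC_loc_continuous_on[OF den_AC_loc, of UNIV] by (simp add: continuous_on_eq_continuous_at)
  then have "\<forall>\<^sub>F t in at x. den t \<noteq> 0"
    using elim(1) by (intro tendsto_imp_eventually_ne) (auto simp: isCont_def)
  then have "\<forall>\<^sub>F t in nhds x. den t \<noteq> 0"
    using elim(1) by (auto simp: eventually_at_filter elim: eventually_mono)
  then have "\<forall>\<^sub>F t in nhds x. sol t = Fin (num t / den t)"
    by eventually_elim (simp add: sol_def)
  moreover have "sol x = Fin (num x / den x)"
    using elim(1) by (simp add: sol_def)
  ultimately show ?case
    using quotient_derivative[OF conjunct1[OF elim(2)] conjunct2[OF elim(2)] elim(1)]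
    unfolding has_sphere_derivative_def
    by (intro exI[of _ "num x / den x"] conjI exI[of _ "\<lambda>t. num t / den t"])
qed

lemma projective_solution_sol:
  assumes "{x. f x = 0} \<in> null_sets lebesgue"
  shows "projective_solution f g h y0 sol"
  using stereographic_sol_AC_loc riccati_ae_sol[OF assms]
  by (simp add: projective_solution_def sol_def quotient_0)

end

section \<open>Identification of the matrix formula with the explicit solution, and
  conclusion\<close>

theorem theorem3:
  fixes f g h F H :: "real \<Rightarrow> complex"
    and M :: "real \<Rightarrow> complex^2^2"
    and y :: "complex \<Rightarrow> real \<Rightarrow> riemann_sphere"
  assumes f: "f \<in> L1_loc" and g: "g \<in> L1_loc" and h: "h \<in> L1_loc"
    and F: "F = (\<lambda>x. - exp (primitive g x) * f x)"
    and H: "H = (\<lambda>x. exp (- primitive g x) * h x)"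
    and M: "M = (\<lambda>x. vector
      [vector [exp (primitive g x / 2) * biv_cosh F H x, exp (primitive g x / 2) * biv_sinh H F x],
       vector [exp (- primitive g x / 2) * biv_sinh F H x, exp (- primitive g x / 2) * biv_cosh H F x]])"
    and y: "y = (\<lambda>y0 x. linear_fractional (M x) (Fin y0))"
  shows "(\<forall>y0 x. y y0 x =
      (if y0 * biv_sinh F H x + biv_cosh H F x = 0 then Infty
       else Fin (exp (primitive g x) * ((y0 * biv_cosh F H x + biv_sinh H F x) /
                   (y0 * biv_sinh F H x + biv_cosh H F x))))) \<and>
    (\<forall>y0. y0 \<notin> singular_curve M \<longrightarrow>
      (\<exists>w. y y0 = Fin \<circ> w \<and> standard_solution f g h y0 w \<and>
           (\<forall>w'. standard_solution f g h y0 w' \<longrightarrow> w' = w))) \<and>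
    (\<forall>y0\<in>singular_curve M. stereographic \<circ> y y0 \<in> AC_loc (sphere 0 1)) \<and>
    ({x. f x = 0} \<in> null_sets lebesgue \<longrightarrow>
      (\<forall>y0\<in>singular_curve M.
         riccati_ae f g h (y y0) \<and> y y0 0 = Fin y0 \<and>
         projective_solution f g h y0 (y y0) \<and>
         (\<forall>z. projective_solution f g h y0 z \<longrightarrow> z = y y0)))"
proof -
  have loc: "riccati f g h F H"
    by (intro riccati.intro f g h F H)
  have formula: "y y0 x =
      (if y0 * biv_sinh F H x + biv_cosh H F x = 0 then Infty
       else Fin (exp (primitive g x) * ((y0 * biv_cosh F H x + biv_sinh H F x) /
                   (y0 * biv_sinh F H x + biv_cosh H F x))))" for y0 x
  proof -
    let ?a = "exp (primitive g x / 2)" and ?b = "exp (- primitive g x / 2)"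
    let ?p = "y0 * biv_cosh F H x + biv_sinh H F x" and ?q = "y0 * biv_sinh F H x + biv_cosh H F x"
    \<comment> \<open>The half exponentials do not cancel in the quotient of the two rows; their
      ratio is the full factor in front of the solution formula.\<close>
    have ab: "?a = exp (primitive g x) * ?b"
      by (simp add: exp_add[symmetric])
    have 1: "M x $ 2 $ 1 * y0 + M x $ 2 $ 2 = ?b * ?q" "M x $ 1 $ 1 * y0 + M x $ 1 $ 2 = ?a * ?p"
      by (simp_all add: M algebra_simps)
    have "?a * ?p / (?b * ?q) = exp (primitive g x) * (?p / ?q)"
      unfolding ab by simp
    then show ?thesis
      unfolding y linear_fractional.simps 1 by simp
  qed
  have sol: "y y0 = riccati.sol g F H y0" for y0
    by (rule ext) (simp add: formula riccati.sol_def[OF loc] riccati.num_def[OF loc] riccati.den_def[OF loc])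
  have den: "riccati.den F H y0 x \<noteq> 0" if y0: "y0 \<notin> singular_curve M" for y0 x
  proof
    assume z: "riccati.den F H y0 x = 0"
    then have q: "y0 * biv_sinh F H x + biv_cosh H F x = 0"
      by (simp add: riccati.den_def[OF loc])
    \<comment> \<open>If this entry vanished, \<open>q\<close> would force
      \<open>biv_cosh H F x\<close> to vanish too, against the determinant. Hence \<open>y0\<close>
      can be solved for and is a point of the singular curve.\<close>
    have s: "biv_sinh F H x \<noteq> 0"
      using q riccati.determinant[OF loc, of x] by auto
    have "y0 * biv_sinh F H x = - biv_cosh H F x"
      using q by (simp only: eq_neg_iff_add_eq_0)
    then have "y0 = - biv_cosh H F x / biv_sinh F H x"
      by (metis s nonzero_mult_div_cancel_right)
    then have "y0 = - (M x $ 2 $ 2) / (M x $ 2 $ 1)" "M x $ 2 $ 1 \<noteq> 0"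
      using s by (simp_all add: M)
    then show False
      using y0 by (auto simp: singular_curve_def)
  qed
  have std: "\<exists>w. y y0 = Fin \<circ> w \<and> standard_solution f g h y0 w \<and>
      (\<forall>w'. standard_solution f g h y0 w' \<longrightarrow> w' = w)" if y0: "y0 \<notin> singular_curve M" for y0
  proof (intro exI conjI allI impI)
    let ?w = "\<lambda>x. riccati.num g F H y0 x / riccati.den F H y0 x"
    show "y y0 = Fin \<circ> ?w"
      by (rule ext) (simp add: sol riccati.sol_def[OF loc] den[OF y0])
    show w: "standard_solution f g h y0 ?w"
      by (rule riccati.standard_solution_quotient[OF loc den[OF y0]])
    fix w' assume "standard_solution f g h y0 w'"
    from projective_solution_unique[OF f g h standard_imp_projective[OF this] standard_imp_projective[OF w]]
    have "Fin \<circ> w' = Fin \<circ> ?w" .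
    then show "w' = ?w"
      by (simp add: fun_eq_iff)
  qed
  have proj: "riccati_ae f g h (y y0) \<and> y y0 0 = Fin y0 \<and> projective_solution f g h y0 (y y0) \<and>
      (\<forall>z. projective_solution f g h y0 z \<longrightarrow> z = y y0)" if "{x. f x = 0} \<in> null_sets lebesgue" for y0
  proof -
    have p: "projective_solution f g h y0 (y y0)"
      unfolding sol by (rule riccati.projective_solution_sol[OF loc that])
    then show ?thesis
      using projective_solution_unique[OF f g h] unfolding projective_solution_def by blast
  qed
  show ?thesis
    using formula std proj riccati.stereographic_sol_AC_loc[OF loc] unfolding sol by blast
qed

end
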